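(* Let $n$ be given, and let $k^\sharp$ be a sufficiently large integer depending only on $n$ (i.e. there is an integer $k_0$ depending only on $n$ such that the following holds for every integer $k^\sharp \ge k_0$, where $k^\sharp$ is the number of auxiliary points used in the definition of Glaeser refinement). Let $E \subseteq \mathbb{R}^n$ be compact and let $f : E \to [0,\infty)$ be given. For each $x \in E$, let $\Phi_0(x) := \Gamma_f^{(1)}(x)$, and for $\ell \ge 0$ let $\Phi_{\ell+1}(x)$ be the Glaeser refinement of $\Phi_\ell(x)$ (with $m=1$). If $\Phi_{2n+3}(x) \neq \varnothing$ for each $x \in E$, then there exists $F \in C^1_+(\mathbb{R}^n)$ such that $J_x^1 F \in \Gamma_f^{(1)}(x)$ for each $x \in E$. In particular, there exists $F \in C^1_+(\mathbb{R}^n)$ such that $F = f$ on $E$.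
   Context: $C^1(\mathbb{R}^n)$ is the vector space of continuously differentiable real-valued functions on $\mathbb{R}^n$ that are bounded together with their first-order partial derivatives. $C^1_+(\mathbb{R}^n)$ is the set of $F \in C^1(\mathbb{R}^n)$ with $F \ge 0$ on $\mathbb{R}^n$. $\mathcal{P}^1$ is the space of real polynomials in $n$ variables of degree at most $1$. For $x \in \mathbb{R}^n$ and a continuously differentiable $F$, $J_x^1F \in \mathcal{P}^1$ is the degree $1$ Taylor polynomial $J_x^1F(y) = F(x) + \nabla F(x)\cdot (y-x)$. For $f: E \to [0,\infty)$ and $x \in E$, $$\Gamma_f^{(1)}(x) := \{P \in \mathcal{P}^1 : \text{there exists } F \in C^1_+(\mathbb{R}^n) \text{ with } F(x) = f(x) \text{ and } J_x^1 F = P\}.$$ Glaeser refinement (for $m=1$). Let $E\subseteq\mathbb{R}^n$ be compact and suppose that for each $x \in E$ a (possibly empty) subset $\Phi_\ell(x) \subseteq \mathcal{P}^1$ is given. The Glaeser refinement of $\Phi_\ell(x_0)$, $x_0 \in E$, is the set $\Phi_{\ell+1}(x_0)$ of all $P_0 \in \mathcal{P}^1$ such that: given $\epsilon>0$, there exists $\delta>0$ such that for any $x_1,\dots,x_{k^\sharp} \in E \cap B(x_0,\delta)$ there exist $P_1,\dots,P_{k^\sharp} \in \mathcal{P}^1$, with $P_j \in \Phi_\ell(x_j)$ for $j = 0,\dots,k^\sharp$, such that $$|\partial^\alpha (P_i-P_j)(x_i)| \le \epsilon |x_i-x_j|^{1-|\alpha|} \quad\text{for } |\alpha|\le 1 \text{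 and } 0\le i,j\le k^\sharp,$$ with $0^0$ read as $1$. Here $B(x_0,\delta)$ is the open Euclidean ball of radius $\delta$ centered at $x_0$. *)

theory Defs
  imports "HOL-Analysis.Analysis"
begin

definition partial_deriv :: "'n \<Rightarrow> (real ^ 'n \<Rightarrow> real) \<Rightarrow> real ^ 'n \<Rightarrow> real" where
  "partial_deriv i F x = frechet_derivative F (at x) (axis i 1)"

definition gradient :: "(real ^ 'n \<Rightarrow> real) \<Rightarrow> real ^ 'n \<Rightarrow> real ^ 'n" where
  "gradient F x = (\<chi> i. partial_deriv i F x)"

definition C1_bounded :: "(real ^ 'n \<Rightarrow> real) set" where
  "C1_bounded = {F. (\<forall>x. F differentiable (at x)) \<and>
     (\<forall>i. continuous_on UNIV (partial_deriv i F)) \<and>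
     bounded (range F) \<and> (\<forall>i. bounded (range (partial_deriv i F)))}"

definition C1_nonneg :: "(real ^ 'n \<Rightarrow> real) set" where
  "C1_nonneg = {F \<in> C1_bounded. \<forall>x. 0 \<le> F x}"

text \<open>Polynomials are identified with the functions they define on the whole space.\<close>

definition polys1 :: "(real ^ 'n \<Rightarrow> real) set" where
  "polys1 = {P. \<exists>a b. P = (\<lambda>y. a + b \<bullet> y)}"

definition jet1 :: "real ^ 'n \<Rightarrow> (real ^ 'n \<Rightarrow> real) \<Rightarrow> real ^ 'n \<Rightarrow> real" where
  "jet1 x F = (\<lambda>y. F x + gradient F x \<bullet> (y - x))"

definition Gamma1 :: "(real ^ 'n \<Rightarrow> real) \<Rightarrow> real ^ 'n \<Rightarrow> (real ^ 'n \<Rightarrow> real) set" where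
  "Gamma1 f x = {P \<in> polys1. \<exists>F \<in> C1_nonneg. F x = f x \<and> jet1 x F = P}"

text \<open>
  In the refinement the auxiliary points are \<open>x 1, \<dots>, x k\<close>, while \<open>x 0\<close> is the base point
  and \<open>P 0\<close> the polynomial being tested. The last two conjuncts are the multi-indices of order
  0 and 1; the factor for order 1 is \<open>dist (x i) (x j) ^ 0\<close>, which is 1 even for coinciding points.
\<close>

definition glaeser_refinement ::
    "nat \<Rightarrow> (real ^ 'n) set \<Rightarrow> (real ^ 'n \<Rightarrow> (real ^ 'n \<Rightarrow> real) set)
      \<Rightarrow> real ^ 'n \<Rightarrow> (real ^ 'n \<Rightarrow> real) set" where
  "glaeser_refinement k E \<Phi> x0 = {P0 \<in> polys1.
     \<forall>\<epsilon>>0. \<exists>\<delta>>0. \<forall>x :: nat \<Rightarrow> real ^ 'n.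
       x 0 = x0 \<and> (\<forall>j\<in>{1..k}. x j \<in> E \<inter> ball x0 \<delta>) \<longrightarrow>
       (\<exists>P :: nat \<Rightarrow> real ^ 'n \<Rightarrow> real.
          P 0 = P0 \<and> (\<forall>j\<le>k. P j \<in> polys1 \<and> P j \<in> \<Phi> (x j)) \<and>
          (\<forall>i\<le>k. \<forall>j\<le>k.
             \<bar>P i (x i) - P j (x i)\<bar> \<le> \<epsilon> * dist (x i) (x j) ^ 1 \<and>
             (\<forall>a. \<bar>partial_deriv a (\<lambda>y. P i y - P j y) (x i)\<bar> \<le> \<epsilon> * dist (x i) (x j) ^ 0)))}"

primrec glaeser_iterate ::
    "nat \<Rightarrow> (real ^ 'n) set \<Rightarrow> (real ^ 'n \<Rightarrow> real) \<Rightarrow> nat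
      \<Rightarrow> real ^ 'n \<Rightarrow> (real ^ 'n \<Rightarrow> real) set" where
  "glaeser_iterate k E f 0 = Gamma1 f"
| "glaeser_iterate k E f (Suc l) = glaeser_refinement k E (glaeser_iterate k E f l)"

end

(*
  The polynomials in Gamma1 f x are f x + b . (y - x) with b arbitrary if f x > 0 and b = 0 if
  f x = 0. As soon as two auxiliary points are available, a gradient b that survives the first
  refinement is a strict derivative of f along E at x; the fibres of such b are affine, and every
  further refinement leaves at most those b near which all neighbouring fibres have an element.
  By a dimension count this process is stationary after 2n + 1 steps, so the stable fibres form a
  lower semicontinuous bundle with nonempty affine values, and Michael's theorem gives a continuous
  selection b. Since b x is a strict derivative of f at each x, (f, b) is a C^1 Whitney field.

  A nonnegative field whose gradient vanishes wherever its value does is extended by successive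
  approximation: at a fine enough scale one finds a C^1 function G >= 0 of controlled norm whose
  residual (f - G, b - grad G) is a field of the same kind and of arbitrarily small norm. The sum
  of the functions G obtained by iterating this is the extension.
*)

theory Submission
  imports Defs
begin

section \<open>Smooth partitions of unity\<close>

text \<open>The obstacle is nonnegativity near the zeros of f. The affine piece with value
  \<open>f x\<close> and slope \<open>b x\<close> turns negative at distance \<open>f x\<close> /
  |\<open>b x\<close>|, and for a field that is merely C^1 no inequality such as |b|^2 <= C f is
  available: compactness makes b small where f is small, but at no rate. Hence the pieces are made
  nonnegative only at one fixed scale and up to an error, and the error is treated as a new field.
  For this to repeat, the residual must again have zero gradient at its zeros, so the approximant is
  kept strictly below f wherever f is positive; and the bound \<open>C * M\<close> must not depend
  on the scale, so that it follows the halving of M.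

  On the bundle side, only the inclusion of the refinements in iterated lower semicontinuous parts
  is carried along. The count 2n + 3 is one refinement to reach the strict derivatives, followed by
  2n + 2 lower semicontinuous parts, the last of which removes nothing from the one before.\<close>

definition C1_fun :: "('a::euclidean_space \<Rightarrow> real) \<Rightarrow> bool" where
  "C1_fun F \<longleftrightarrow>
     (\<exists>g. continuous_on UNIV g \<and> (\<forall>x. (F has_derivative (\<lambda>h. g x \<bullet> h)) (at x)))"

lemma C1_funI:
  assumes "continuous_on UNIV g" "\<And>x. (F has_derivative (\<lambda>h. g x \<bullet> h)) (at x)"
  shows "C1_fun F"
  using assms unfolding C1_fun_def by blast

lemma C1_fun_const: "C1_fun (\<lambda>x. c)"
  by (rule C1_funI[where g = "\<lambda>x. 0"]) (auto intro!: derivative_eq_intros)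

lemma C1_fun_affine: "C1_fun (\<lambda>x. a + b \<bullet> (x - e))"
  by (rule C1_funI[where g = "\<lambda>x. b"]) (auto intro!: derivative_eq_intros)

lemma C1_fun_add:
  assumes "C1_fun F" "C1_fun G"
  shows "C1_fun (\<lambda>x. F x + G x)"
proof -
  obtain f g where "continuous_on UNIV f" "\<And>x. (F has_derivative (\<lambda>h. f x \<bullet> h)) (at x)"
    "continuous_on UNIV g" "\<And>x. (G has_derivative (\<lambda>h. g x \<bullet> h)) (at x)"
    using assms unfolding C1_fun_def by blast
  then show ?thesis
    by (intro C1_funI[where g = "\<lambda>x. f x + g x"])
       (auto intro!: continuous_intros derivative_eq_intros simp: inner_add_left)
qed

lemma C1_fun_mult:
  assumes "C1_fun F" "C1_fun G"
  shows "C1_fun (\<lambda>x. F x * G x)"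
proof -
  obtain f g where fg: "continuous_on UNIV f" "\<And>x. (F has_derivative (\<lambda>h. f x \<bullet> h)) (at x)"
    "continuous_on UNIV g" "\<And>x. (G has_derivative (\<lambda>h. g x \<bullet> h)) (at x)"
    using assms unfolding C1_fun_def by blast
  then have "continuous_on UNIV F" "continuous_on UNIV G"
    by (meson has_derivative_continuous continuous_at_imp_continuous_on)+
  with fg show ?thesis
    by (intro C1_funI[where g = "\<lambda>x. F x *\<^sub>R g x + G x *\<^sub>R f x"])
       (auto intro!: continuous_intros derivative_eq_intros simp: inner_add_left)
qed

lemma C1_fun_sum:
  assumes "\<And>i. i \<in> I \<Longrightarrow> C1_fun (F i)"
  shows "C1_fun (\<lambda>x. \<Sum>i\<in>I. F i x)"
proof (cases "finite I")
  case True
  then show ?thesis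
    using assms by (induction I) (auto intro: C1_fun_const C1_fun_add)
qed (simp add: C1_fun_const)

lemma C1_fun_prod:
  assumes "\<And>i. i \<in> I \<Longrightarrow> C1_fun (F i)"
  shows "C1_fun (\<lambda>x. \<Prod>i\<in>I. F i x)"
proof (cases "finite I")
  case True
  then show ?thesis
    using assms by (induction I) (auto intro: C1_fun_const C1_fun_mult)
qed (simp add: C1_fun_const)

lemma C1_fun_compose:
  assumes "C1_fun F" "\<And>t. (c has_real_derivative c' t) (at t)" "continuous_on UNIV c'"
  shows "C1_fun (\<lambda>x. c (F x))"
proof -
  obtain g where g: "continuous_on UNIV g" "\<And>x. (F has_derivative (\<lambda>h. g x \<bullet> h)) (at x)"
    using assms unfolding C1_fun_def by blast
  then have F: "continuous_on UNIV F"
    by (meson has_derivative_continuous continuous_at_imp_continuous_on)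
  show ?thesis
  proof (rule C1_funI[where g = "\<lambda>x. c' (F x) *\<^sub>R g x"])
    show "continuous_on UNIV (\<lambda>x. c' (F x) *\<^sub>R g x)"
      using g(1) F assms(3) by (auto intro!: continuous_intros continuous_on_compose2[OF assms(3)])
    show "((\<lambda>x. c (F x)) has_derivative (\<lambda>h. (c' (F x) *\<^sub>R g x) \<bullet> h)) (at x)" for x
      using has_derivative_compose[OF g(2)[of x] assms(2)[of "F x", unfolded has_field_derivative_def]]
      by simp
  qed
qed

text \<open>The function F y - b . y has slope |v|^2 at x in the direction v = g - b, while its
  increments are at most K times the distance. Gradient bounds thus follow from difference
  estimates, and the derivatives of the partition functions never have to be computed.\<close>

lemma gradient_norm_le:
  fixes F :: "'a::euclidean_space \<Rightarrow> real"
  assumes F: "(F has_derivative (\<lambda>h. g \<bullet> h)) (at x)" and "r > 0"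
    and K: "\<And>y. dist x y \<le> r \<Longrightarrow> \<bar>F y - F x - b \<bullet> (y - x)\<bar> \<le> K * dist x y"
  shows "norm (g - b) \<le> K"
proof (cases "g = b")
  case True
  obtain u :: 'a where "norm u = r"
    using \<open>r > 0\<close> by (metis less_eq_real_def vector_choose_size)
  \<comment> \<open>Here only K >= 0 is at stake, and any point at distance r shows it.\<close>
  have "0 \<le> K * r"
    using K[of "x + u"] \<open>norm u = r\<close> by (simp add: dist_norm)
  then show ?thesis using True \<open>r > 0\<close> by (simp add: zero_le_mult_iff)
next
  case False
  define v where "v = g - b"
  have v: "v \<noteq> 0" using False by (simp add: v_def)
  define \<phi> where "\<phi> = (\<lambda>t. F (x + t *\<^sub>R v) - b \<bullet> (x + t *\<^sub>R v))"
  have "((\<lambda>y. F y - b \<bullet> y) has_derivative (\<lambda>h. g \<bullet> h - b \<bullet> h)) (at x)"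
    using F by (auto intro!: derivative_eq_intros)
  then have 1: "((\<lambda>y. F y - b \<bullet> y) has_derivative (\<lambda>h. g \<bullet> h - b \<bullet> h)) (at (x + 0 *\<^sub>R v))"
    by simp
  have 2: "((\<lambda>t. x + t *\<^sub>R v) has_derivative (\<lambda>t. t *\<^sub>R v)) (at 0)"
    by (auto intro!: derivative_eq_intros)
  have "(\<phi> has_derivative (\<lambda>t. g \<bullet> (t *\<^sub>R v) - b \<bullet> (t *\<^sub>R v))) (at 0)"
    unfolding \<phi>_def by (rule has_derivative_compose[OF 2 1])
  then have "(\<phi> has_real_derivative (v \<bullet> v)) (at 0)"
    by (rule has_derivative_imp_has_field_derivative) (simp add: v_def algebra_simps)
  then have lim: "((\<lambda>t. (\<phi> t - \<phi> 0) / t) \<longlongrightarrow> v \<bullet> v) (at 0)"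
    by (simp add: DERIV_def)
  have ev: "\<forall>\<^sub>F t in at 0. (\<phi> t - \<phi> 0) / t \<le> K * norm v"
    unfolding eventually_at
  proof (intro exI[of _ "r / norm v"] conjI ballI impI)
    show "0 < r / norm v" using \<open>r > 0\<close> v by simp
    fix t :: real assume t: "t \<noteq> 0 \<and> dist t 0 < r / norm v"
    have "dist x (x + t *\<^sub>R v) \<le> r"
      using t v by (simp add: dist_norm field_simps)
    from K[OF this] have "\<bar>\<phi> t - \<phi> 0\<bar> \<le> K * (\<bar>t\<bar> * norm v)"
      by (simp add: \<phi>_def dist_norm algebra_simps)
    then have "\<bar>(\<phi> t - \<phi> 0) / t\<bar> \<le> K * norm v"
      using t by (simp add: field_simps)
    then show "(\<phi> t - \<phi> 0) / t \<le> K * norm v" by linarith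
  qed
  have "v \<bullet> v \<le> K * norm v"
    using tendsto_upperbound[OF lim ev] by simp
  then show ?thesis using v by (simp add: v_def dot_square_norm power2_eq_square)
qed

section \<open>A C^1 step and a C^1 bump on the real line\<close>

definition smooth_step :: "real \<Rightarrow> real" where
  "smooth_step t = 2 * (max 0 t)\<^sup>2 - 4 * (max 0 (t - 1/2))\<^sup>2 + 2 * (max 0 (t - 1))\<^sup>2"

text \<open>A tent over [0, 1] with peak 2 at 1/2; its primitive \<open>smooth_step\<close> is 2 t^2
  up to 1/2, then 1 - 2 (1 - t)^2, then 1. Positive parts leave a single breakpoint to differentiate
  at, in \<open>DERIV_pos_part_square\<close>.\<close>

definition smooth_step' :: "real \<Rightarrow> real" where
  "smooth_step' t = 4 * max 0 t - 8 * max 0 (t - 1/2) + 4 * max 0 (t - 1)"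

lemma DERIV_pos_part_square:
  fixes t :: real
  shows "((\<lambda>t. (max 0 t)\<^sup>2) has_real_derivative 2 * max 0 t) (at t)"
proof -
  consider "t > 0" | "t < 0" | "t = 0" by linarith
  then show ?thesis
  proof cases
    case 1
    have "((\<lambda>t. t\<^sup>2) has_real_derivative 2 * max 0 t) (at t)"
      using 1 by (auto intro!: derivative_eq_intros)
    then show ?thesis
      by (rule has_field_derivative_transform_within_open[where S = "{0<..}"]) (use 1 in auto)
  next
    case 2
    have "((\<lambda>t. 0) has_real_derivative 2 * max 0 t) (at t)"
      using 2 by (auto intro!: derivative_eq_intros)
    then show ?thesis
      by (rule has_field_derivative_transform_within_open[where S = "{..<0}"]) (use 2 in auto)
  next
    case 3
    have *: "(\<lambda>h::real. (max 0 h)\<^sup>2 / h) = (\<lambda>h. max 0 h)"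
      by (auto simp: max_def power2_eq_square)
    have "((\<lambda>h::real. max 0 h) \<longlongrightarrow> max 0 0) (at 0)"
      by (intro tendsto_intros)
    then show ?thesis using 3 by (simp add: DERIV_def * cong: if_cong)
  qed
qed

lemma DERIV_smooth_step: "(smooth_step has_real_derivative smooth_step' t) (at t)"
proof -
  have *: "((\<lambda>t. (max 0 (t - c))\<^sup>2) has_real_derivative 2 * max 0 (t - c)) (at t)" for c :: real
    using DERIV_shift[of "\<lambda>t. (max 0 t)\<^sup>2" "2 * max 0 (t - c)" t "- c"]
      DERIV_pos_part_square[of "t - c"] by simp
  show ?thesis
    using DERIV_add[OF DERIV_diff[OF DERIV_cmult[OF *[of 0], of 2] DERIV_cmult[OF *[of "1/2"], of 4]]
        DERIV_cmult[OF *[of 1], of 2]]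
    by (simp add: smooth_step_def[abs_def] smooth_step'_def)
qed

lemma continuous_on_smooth_step': "continuous_on UNIV smooth_step'"
  unfolding smooth_step'_def[abs_def] by (intro continuous_intros)

lemma smooth_step'_bounds: "0 \<le> smooth_step' t" "smooth_step' t \<le> 2"
  by (auto simp: smooth_step'_def max_def)

lemma smooth_step_mono: "s \<le> t \<Longrightarrow> smooth_step s \<le> smooth_step t"
  using DERIV_nonneg_imp_nondecreasing[of s t smooth_step] DERIV_smooth_step smooth_step'_bounds
  by blast

lemma smooth_step_Lipschitz: "\<bar>smooth_step s - smooth_step t\<bar> \<le> 2 * \<bar>s - t\<bar>"
  using field_differentiable_bound[of UNIV smooth_step smooth_step' 2 s t]
    DERIV_smooth_step smooth_step'_bounds by (auto simp: has_field_derivative_at_within)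

lemma smooth_step_le_0: "t \<le> 0 \<Longrightarrow> smooth_step t = 0"
  by (simp add: smooth_step_def max_def)

lemma smooth_step_ge_1: "1 \<le> t \<Longrightarrow> smooth_step t = 1"
  by (simp add: smooth_step_def max_def power2_eq_square algebra_simps)

lemma smooth_step_range: "0 \<le> smooth_step t" "smooth_step t \<le> 1"
  using smooth_step_mono[of 0 t] smooth_step_mono[of t 0] smooth_step_mono[of 1 t] smooth_step_mono[of t 1]
    smooth_step_le_0[of t] smooth_step_le_0[of 0] smooth_step_ge_1[of t] smooth_step_ge_1[of 1]
  by linarith+

text \<open>As a difference of consecutive shifts of the step, its integer translates telescope,
  which is why they sum to 1.\<close>

definition bump :: "real \<Rightarrow> real" where
  "bump t = smooth_step (t + 1) - smooth_step t"

definition bump' :: "real \<Rightarrow> real" where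
  "bump' t = smooth_step' (t + 1) - smooth_step' t"

lemma DERIV_bump: "(bump has_real_derivative bump' t) (at t)"
  unfolding bump_def[abs_def] bump'_def
  by (auto intro!: derivative_eq_intros DERIV_smooth_step DERIV_chain2[OF DERIV_smooth_step])

lemma continuous_on_bump': "continuous_on UNIV bump'"
  unfolding bump'_def[abs_def]
  by (intro continuous_intros continuous_on_compose2[OF continuous_on_smooth_step']) auto

lemma bump_range: "0 \<le> bump t" "bump t \<le> 1"
  using smooth_step_mono[of t "t + 1"] smooth_step_range[of t] smooth_step_range[of "t + 1"]
  by (auto simp: bump_def)

lemma bump_nonzero: "bump t \<noteq> 0 \<Longrightarrow> \<bar>t\<bar> < 1"
  using smooth_step_le_0[of t] smooth_step_le_0[of "t+1"] smooth_step_ge_1[of t] smooth_step_ge_1[of "t+1"]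
  by (cases "t \<le> -1"; cases "1 \<le> t") (auto simp: bump_def)

lemma bump_Lipschitz: "\<bar>bump s - bump t\<bar> \<le> 4 * \<bar>s - t\<bar>"
  using smooth_step_Lipschitz[of s t] smooth_step_Lipschitz[of "s+1" "t+1"]
  by (simp add: bump_def)

lemma sum_bump:
  "(\<Sum>j\<in>{- int m..int m}. bump (t - of_int j)) = smooth_step (t + m + 1) - smooth_step (t - m)"
proof (induction m)
  case (Suc m)
  have "{- int (Suc m)..int (Suc m)} = insert (- int (Suc m)) (insert (int (Suc m)) {- int m..int m})"
    by auto
  then show ?case using Suc by (simp add: bump_def algebra_simps)
qed (simp add: bump_def)

text \<open>Finitely many functions suffice because the sum has to be 1 only on the ball of radius
  R. The Lipschitz bound on the sum of all differences already contains the overlap number; its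
  1/\<delta> is the usual size of the gradients at scale \<delta>, and K is independent of the
  scale.\<close>

definition C1_partition ::
    "real \<Rightarrow> real \<Rightarrow> real \<Rightarrow> 'i set \<Rightarrow> ('i \<Rightarrow> 'a::euclidean_space) \<Rightarrow> ('i \<Rightarrow> 'a \<Rightarrow> real) \<Rightarrow> bool" where
  "C1_partition K \<delta> R S p \<phi> \<longleftrightarrow>
     finite S \<and> (\<forall>z\<in>S. C1_fun (\<phi> z)) \<and> (\<forall>z x. 0 \<le> \<phi> z x) \<and>
     (\<forall>z\<in>S. \<forall>x. \<phi> z x \<noteq> 0 \<longrightarrow> dist x (p z) \<le> \<delta>) \<and>
     (\<forall>x. (\<Sum>z\<in>S. \<phi> z x) \<le> 1) \<and> (\<forall>x. norm x \<le> R \<longrightarrow> (\<Sum>z\<in>S. \<phi> z x) = 1) \<and>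
     (\<forall>x y. (\<Sum>z\<in>S. \<bar>\<phi> z x - \<phi> z y\<bar>) \<le> K / \<delta> * dist x y)"

text \<open>Tensor products of \<open>bump\<close> on a cubic lattice. In each coordinate at most
  two integers are at distance below 1, so at most 2^n products are nonzero at a point, whatever the
  mesh.\<close>

lemma partition_of_unity_lattice:
  "\<exists>K\<ge>0. \<forall>\<delta>>0. \<forall>R. \<exists>(S :: ('a::euclidean_space \<Rightarrow> int) set) (p :: _ \<Rightarrow> 'a) \<phi>.
     C1_partition K \<delta> R S p \<phi>"
proof -
  define n where "n = real DIM('a)"
  have n: "n > 0" by (simp add: n_def)
  \<comment> \<open>At most 2 * 2^n indices are active at x or at y. Each product has n factors of
    slope 4/h = 4n/\<delta>, hence Lipschitz constant 4 n n/\<delta>.\<close>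
  define K where "K = 2 * 2 ^ DIM('a) * (4 * n * n)"
  have "K \<ge> 0" using n by (simp add: K_def)
  have *: "\<exists>(S :: ('a \<Rightarrow> int) set) (p :: _ \<Rightarrow> 'a) \<phi>. C1_partition K \<delta> R S p \<phi>" if "\<delta> > 0" for \<delta> R
  proof -
    \<comment> \<open>With this mesh the l^1 distance to the lattice point, at most n h on the
      support, is at most \<delta>.\<close>
    define h where "h = \<delta> / n"
    have h: "h > 0" using that n by (simp add: h_def)
    obtain m :: nat where m: "R / h \<le> real m" using real_arch_simple by blast
    define S :: "('a \<Rightarrow> int) set" where "S = (\<Pi>\<^sub>E i\<in>Basis. {- int m..int m})"
    define \<phi> where "\<phi> = (\<lambda>(z :: 'a \<Rightarrow> int) (x :: 'a). \<Prod>i\<in>Basis. bump ((x \<bullet> i) / h - of_int (z i)))"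
    define p :: "('a \<Rightarrow> int) \<Rightarrow> 'a" where "p = (\<lambda>z. \<Sum>i\<in>Basis. (h * of_int (z i)) *\<^sub>R i)"
    have fin: "finite S" unfolding S_def by (intro finite_PiE) auto
    have C1: "C1_fun (\<phi> z)" for z
    proof -
      have "C1_fun (\<lambda>x::'a. bump (- of_int (z i) + (i /\<^sub>R h) \<bullet> (x - 0)))" for i
        by (intro C1_fun_compose[OF C1_fun_affine DERIV_bump continuous_on_bump'])
      moreover have "- of_int (z i) + (i /\<^sub>R h) \<bullet> (x - 0) = (x \<bullet> i) / h - of_int (z i)" for i x
        by (simp add: inner_commute divide_inverse)
      ultimately show ?thesis unfolding \<phi>_def by (intro C1_fun_prod) simp
    qed
    have nonneg: "0 \<le> \<phi> z x" for z x
      unfolding \<phi>_def by (intro prod_nonneg) (auto simp: bump_range)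
    have near: "\<bar>(x \<bullet> i) / h - of_int (z i)\<bar> < 1" if "\<phi> z x \<noteq> 0" "i \<in> Basis" for z x i
      using that by (intro bump_nonzero) (auto simp: \<phi>_def)
    have supp: "dist x (p z) \<le> \<delta>" if "\<phi> z x \<noteq> 0" for z x
    proof -
      have "dist x (p z) \<le> (\<Sum>i\<in>Basis. \<bar>(x - p z) \<bullet> i\<bar>)"
        unfolding dist_norm by (rule norm_le_l1)
      also have "\<dots> \<le> (\<Sum>i\<in>(Basis::'a set). h)"
      proof (rule sum_mono)
        fix i :: 'a assume i: "i \<in> Basis"
        have "(x - p z) \<bullet> i = x \<bullet> i - h * of_int (z i)"
          using i by (simp add: p_def inner_diff_left inner_sum_left inner_Basis if_distrib cong: if_cong)
        also have "\<dots> = h * ((x \<bullet> i) / h - of_int (z i))"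
          using h by (simp add: field_simps)
        finally show "\<bar>(x - p z) \<bullet> i\<bar> \<le> h"
          using near[OF that i] h by (simp add: abs_mult)
      qed
      also have "\<dots> = \<delta>" using n by (simp add: h_def n_def)
      finally show ?thesis .
    qed
    have tot: "(\<Sum>z\<in>S. \<phi> z x) = (\<Prod>i\<in>Basis. smooth_step ((x \<bullet> i) / h + m + 1) - smooth_step ((x \<bullet> i) / h - m))" for x
      unfolding \<phi>_def S_def sum_bump[symmetric] by (subst prod_sum_PiE) auto
    have le1: "(\<Sum>z\<in>S. \<phi> z x) \<le> 1" for x
      unfolding tot
    proof (intro prod_le_1 conjI)
      fix i :: 'a
      show "0 \<le> smooth_step ((x \<bullet> i) / h + m + 1) - smooth_step ((x \<bullet> i) / h - m)"
        using smooth_step_mono[of "(x \<bullet> i) / h - m" "(x \<bullet> i) / h + m + 1"] by simp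
      show "smooth_step ((x \<bullet> i) / h + m + 1) - smooth_step ((x \<bullet> i) / h - m) \<le> 1"
        using smooth_step_range[of "(x \<bullet> i) / h + m + 1"] smooth_step_range[of "(x \<bullet> i) / h - m"] by simp
    qed
    have eq1: "(\<Sum>z\<in>S. \<phi> z x) = 1" if "norm x \<le> R" for x
      unfolding tot
    proof (rule prod.neutral, rule ballI)
      fix i :: 'a assume i: "i \<in> Basis"
      have "\<bar>(x \<bullet> i) / h\<bar> \<le> R / h"
        using Basis_le_norm[OF i, of x] that h by (simp add: divide_right_mono)
      with m have "\<bar>(x \<bullet> i) / h\<bar> \<le> m" by linarith
      then show "smooth_step ((x \<bullet> i) / h + m + 1) - smooth_step ((x \<bullet> i) / h - m) = 1"
        by (subst smooth_step_ge_1, linarith, subst smooth_step_le_0) (linarith, simp)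
    qed
    define T where "T = (\<lambda>x. {z \<in> S. \<phi> z x \<noteq> 0})"
    have cardT: "card (T x) \<le> 2 ^ DIM('a)" for x
    proof -
      have "T x \<subseteq> (\<Pi>\<^sub>E i\<in>Basis. {\<lfloor>(x \<bullet> i) / h\<rfloor>, \<lfloor>(x \<bullet> i) / h\<rfloor> + 1})"
      proof
        fix z assume z: "z \<in> T x"
        have "z i \<in> {\<lfloor>(x \<bullet> i) / h\<rfloor>, \<lfloor>(x \<bullet> i) / h\<rfloor> + 1}" if "i \<in> Basis" for i
        proof -
          have "\<bar>(x \<bullet> i) / h - of_int (z i)\<bar> < 1" using near z that by (auto simp: T_def)
          then have "z i = \<lfloor>(x \<bullet> i) / h\<rfloor> \<or> z i = \<lfloor>(x \<bullet> i) / h\<rfloor> + 1" by linarith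
          then show ?thesis by simp
        qed
        with z show "z \<in> (\<Pi>\<^sub>E i\<in>Basis. {\<lfloor>(x \<bullet> i) / h\<rfloor>, \<lfloor>(x \<bullet> i) / h\<rfloor> + 1})"
          by (auto simp: T_def S_def PiE_def)
      qed
      then have "card (T x) \<le> card (\<Pi>\<^sub>E i\<in>Basis. {\<lfloor>(x \<bullet> i) / h\<rfloor>, \<lfloor>(x \<bullet> i) / h\<rfloor> + 1})"
        by (intro card_mono finite_PiE) auto
      also have "\<dots> = 2 ^ DIM('a)" by (simp add: card_PiE numeral_2_eq_2)
      finally show ?thesis .
    qed
    have lip: "\<bar>\<phi> z x - \<phi> z y\<bar> \<le> (4 * n * n) / \<delta> * dist x y" for z x y
    proof -
      have "\<bar>\<phi> z x - \<phi> z y\<bar> \<le> (\<Sum>i\<in>Basis. \<bar>bump ((x \<bullet> i) / h - of_int (z i)) - bump ((y \<bullet> i) / h - of_int (z i))\<bar>)"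
        unfolding \<phi>_def using norm_prod_diff[of Basis "\<lambda>i. bump ((x \<bullet> i) / h - of_int (z i))" "\<lambda>i. bump ((y \<bullet> i) / h - of_int (z i))"]
        by (auto simp: bump_range)
      also have "\<dots> \<le> (\<Sum>i\<in>(Basis :: 'a set). 4 * (dist x y / h))"
      proof (rule sum_mono)
        fix i :: 'a assume i: "i \<in> Basis"
        have "\<bar>(x \<bullet> i) / h - (y \<bullet> i) / h\<bar> = \<bar>(x - y) \<bullet> i\<bar> / h"
          using h by (simp add: inner_diff_left diff_divide_distrib[symmetric])
        also have "\<dots> \<le> dist x y / h"
          using Basis_le_norm[OF i, of "x - y"] h by (simp add: divide_right_mono dist_norm)
        finally show "\<bar>bump ((x \<bullet> i) / h - of_int (z i)) - bump ((y \<bullet> i) / h - of_int (z i))\<bar> \<le> 4 * (dist x y / h)"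
          using bump_Lipschitz[of "(x \<bullet> i) / h - of_int (z i)" "(y \<bullet> i) / h - of_int (z i)"]
          by (smt (verit, best))
      qed
      also have "\<dots> = (4 * n * n) / \<delta> * dist x y" using n by (simp add: h_def n_def)
      finally show ?thesis .
    qed
    have K: "(\<Sum>z\<in>S. \<bar>\<phi> z x - \<phi> z y\<bar>) \<le> K / \<delta> * dist x y" for x y
    proof -
      have "(\<Sum>z\<in>S. \<bar>\<phi> z x - \<phi> z y\<bar>) = (\<Sum>z\<in>T x \<union> T y. \<bar>\<phi> z x - \<phi> z y\<bar>)"
        by (rule sum.mono_neutral_right) (use fin in \<open>auto simp: T_def\<close>)
      also have "\<dots> \<le> real (card (T x \<union> T y)) * ((4 * n * n) / \<delta> * dist x y)"
        using lip by (intro sum_bounded_above) auto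
      also have "\<dots> \<le> (2 * 2 ^ DIM('a)) * ((4 * n * n) / \<delta> * dist x y)"
      proof (rule mult_right_mono)
        have "card (T x \<union> T y) \<le> 2 * 2 ^ DIM('a)"
          using card_Un_le[of "T x" "T y"] cardT[of x] cardT[of y] by linarith
        then have "real (card (T x \<union> T y)) \<le> real (2 * 2 ^ DIM('a))"
          by (rule of_nat_mono)
        then show "real (card (T x \<union> T y)) \<le> 2 * 2 ^ DIM('a)" by simp
        show "0 \<le> 4 * n * n / \<delta> * dist x y" using \<open>\<delta> > 0\<close> n by simp
      qed
      also have "\<dots> = K / \<delta> * dist x y" by (simp add: K_def)
      finally show ?thesis .
    qed
    show ?thesis
      by (rule exI[of _ S], rule exI[of _ p], rule exI[of _ \<phi>])
         (use supp eq1 K in \<open>simp add: C1_partition_def fin C1 nonneg le1\<close>)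
  qed
  show ?thesis
    using \<open>K \<ge> 0\<close> * by (intro exI[of _ K]) simp
qed

section \<open>Nonnegative Whitney extension\<close>

text \<open>Whitney's condition of order 1 with remainders uniform over E. The clause on zeros is
  forced by a nonnegative extension, which has a minimum there.\<close>

definition whitney_field :: "'a::euclidean_space set \<Rightarrow> ('a \<Rightarrow> real) \<Rightarrow> ('a \<Rightarrow> 'a) \<Rightarrow> bool" where
  "whitney_field E f b \<longleftrightarrow>
     (\<forall>x\<in>E. 0 \<le> f x \<and> (f x = 0 \<longrightarrow> b x = 0)) \<and>
     (\<forall>\<epsilon>>0. \<exists>\<delta>>0. \<forall>x\<in>E. \<forall>y\<in>E. dist x y < \<delta> \<longrightarrow>
        \<bar>f y - f x - b x \<bullet> (y - x)\<bar> \<le> \<epsilon> * dist x y \<and> norm (b y - b x) \<le> \<epsilon>)"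

text \<open>The Lipschitz constant of f on E is listed separately because E need not be connected,
  so b does not control increments of f between distant points.\<close>

definition field_bound :: "'a::euclidean_space set \<Rightarrow> ('a \<Rightarrow> real) \<Rightarrow> ('a \<Rightarrow> 'a) \<Rightarrow> real \<Rightarrow> bool" where
  "field_bound E f b M \<longleftrightarrow>
     (\<forall>x\<in>E. f x \<le> M \<and> norm (b x) \<le> M \<and> (\<forall>y\<in>E. \<bar>f x - f y\<bar> \<le> M * dist x y))"

text \<open>The mean value inequality is used on segments, which may leave E; uniform continuity of
  the gradient is therefore taken on a ball around E. This keeps f - G a Whitney field.\<close>

lemma C1_uniform_taylor:
  fixes G :: "'a::euclidean_space \<Rightarrow> real"
  assumes "continuous_on UNIV g" "\<And>x. (G has_derivative (\<lambda>h. g x \<bullet> h)) (at x)"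
    and "compact E" "\<epsilon> > 0"
  shows "\<exists>\<delta>>0. \<forall>x\<in>E. \<forall>y\<in>E. dist x y < \<delta> \<longrightarrow>
           \<bar>G y - G x - g x \<bullet> (y - x)\<bar> \<le> \<epsilon> * dist x y \<and> norm (g y - g x) \<le> \<epsilon>"
proof -
  obtain R where R: "E \<subseteq> cball 0 R"
    using bounded_subset_ballD[OF compact_imp_bounded[OF \<open>compact E\<close>], of 0] ball_subset_cball by (meson order_trans)
  have "uniformly_continuous_on (cball 0 R) g"
    by (rule compact_uniformly_continuous) (use assms in \<open>auto intro: continuous_on_subset\<close>)
  then obtain \<delta> where \<delta>: "\<delta> > 0"
    "\<And>x y. x \<in> cball 0 R \<Longrightarrow> y \<in> cball 0 R \<Longrightarrow> dist y x < \<delta> \<Longrightarrow> dist (g y) (g x) < \<epsilon>"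
    using \<open>\<epsilon> > 0\<close> unfolding uniformly_continuous_on_def by metis
  have "\<bar>G y - G x - g x \<bullet> (y - x)\<bar> \<le> \<epsilon> * dist x y \<and> norm (g y - g x) \<le> \<epsilon>"
    if xy: "x \<in> E" "y \<in> E" "dist x y < \<delta>" for x y
  proof
    define \<psi> where "\<psi> = (\<lambda>z. G z - g x \<bullet> z)"
    have "norm (\<psi> y - \<psi> x) \<le> \<epsilon> * norm (y - x)"
    proof (rule differentiable_bound[where S = "closed_segment x y" and f' = "\<lambda>z h. (g z - g x) \<bullet> h"])
      show "(\<psi> has_derivative (\<lambda>h. (g z - g x) \<bullet> h)) (at z within closed_segment x y)" for z
        unfolding \<psi>_def inner_diff_left
        by (intro has_derivative_diff has_derivative_at_withinI[OF assms(2)])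
           (auto intro!: derivative_eq_intros)
      show "onorm ((\<bullet>) (g z - g x)) \<le> \<epsilon>" if z: "z \<in> closed_segment x y" for z
      proof (rule onorm_le)
        fix h :: 'a
        have "z \<in> cball 0 R"
          using z closed_segment_subset[of x "cball 0 R" y] R xy convex_cball by blast
        moreover have "dist z x < \<delta>"
          using segment_bound1[OF z] xy by (simp add: dist_norm norm_minus_commute)
        ultimately have "norm (g z - g x) \<le> \<epsilon>"
          using \<delta>(2)[of x z] R xy by (auto simp: dist_norm)
        then show "norm ((g z - g x) \<bullet> h) \<le> \<epsilon> * norm h"
          by (metis Cauchy_Schwarz_ineq2 mult_right_mono norm_ge_zero order_trans real_norm_def)
      qed
    qed auto
    then show "\<bar>G y - G x - g x \<bullet> (y - x)\<bar> \<le> \<epsilon> * dist x y"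
      by (simp add: \<psi>_def dist_norm norm_minus_commute algebra_simps)
    have "dist (g y) (g x) < \<epsilon>"
      using xy R by (intro \<delta>(2)) (auto simp: dist_commute)
    then show "norm (g y - g x) \<le> \<epsilon>"
      by (simp add: dist_norm)
  qed
  with \<delta>(1) show ?thesis by blast
qed

text \<open>McShane's extension, a supremum of cones of slope M, cut off at 0. The cones have height
  at most M, so they are nonpositive at distance 1 from E, which bounds the support.\<close>

lemma Lipschitz_extension_compact_support:
  fixes f :: "'a::euclidean_space \<Rightarrow> real"
  assumes "compact E" "E \<noteq> {}" "M > 0"
    and f: "\<And>x. x \<in> E \<Longrightarrow> 0 \<le> f x" "\<And>x. x \<in> E \<Longrightarrow> f x \<le> M"
      "\<And>x y. x \<in> E \<Longrightarrow> y \<in> E \<Longrightarrow> \<bar>f x - f y\<bar> \<le> M * dist x y"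
  shows "\<exists>F R. E \<subseteq> cball 0 R \<and> (\<forall>x\<in>E. F x = f x) \<and> (\<forall>x. 0 \<le> F x \<and> F x \<le> M) \<and>
           (\<forall>x y. \<bar>F x - F y\<bar> \<le> M * dist x y) \<and> (\<forall>x. F x \<noteq> 0 \<longrightarrow> norm x \<le> R)"
proof -
  obtain R where R: "E \<subseteq> cball 0 R"
    using bounded_subset_ballD[OF compact_imp_bounded[OF \<open>compact E\<close>], of 0] ball_subset_cball by (meson order_trans)
  define H where "H = (\<lambda>x. SUP e\<in>E. f e - M * dist x e)"
  have bdd: "bdd_above ((\<lambda>e. f e - M * dist x e) ` E)" for x
  proof (rule bdd_aboveI2)
    fix e assume "e \<in> E"
    moreover have "0 \<le> M * dist x e" using \<open>M > 0\<close> by simp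
    ultimately show "f e - M * dist x e \<le> M" using f(2)[of e] by linarith
  qed
  have H_ge: "f e - M * dist x e \<le> H x" if "e \<in> E" for e x
    unfolding H_def using bdd that by (intro cSUP_upper)
  have H_leI: "H x \<le> c" if "\<And>e. e \<in> E \<Longrightarrow> f e - M * dist x e \<le> c" for c x
    unfolding H_def using that \<open>E \<noteq> {}\<close> by (intro cSUP_least)
  have H_eq: "H x = f x" if "x \<in> E" for x
  proof (rule antisym)
    show "H x \<le> f x"
    proof (rule H_leI)
      fix e assume "e \<in> E"
      then show "f e - M * dist x e \<le> f x" using f(3)[of x e] that by linarith
    qed
    show "f x \<le> H x" using H_ge[OF that, of x] by simp
  qed
  have H_lip: "H x \<le> H y + M * dist x y" for x y
  proof (rule H_leI)
    fix e assume e: "e \<in> E"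
    have "M * dist y e \<le> M * (dist x y + dist x e)"
      using \<open>M > 0\<close> by (intro mult_left_mono) (use dist_triangle[of y e x] in \<open>auto simp: dist_commute\<close>)
    then show "f e - M * dist x e \<le> H y + M * dist x y"
      using H_ge[OF e, of y] by (simp add: algebra_simps)
  qed
  define F where "F = (\<lambda>x. max 0 (H x))"
  have "F x = f x" if "x \<in> E" for x using H_eq f(1) that by (simp add: F_def max_def)
  moreover have "H x \<le> M" for x
  proof (rule H_leI)
    fix e assume "e \<in> E"
    moreover have "0 \<le> M * dist x e" using \<open>M > 0\<close> by simp
    ultimately show "f e - M * dist x e \<le> M" using f(2)[of e] by linarith
  qed
  then have "0 \<le> F x \<and> F x \<le> M" for x using \<open>M > 0\<close> by (simp add: F_def)
  moreover have "\<bar>F x - F y\<bar> \<le> M * dist x y" for x y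
    using H_lip[of x y] H_lip[of y x] by (auto simp: F_def max_def dist_commute)
  moreover have "norm x \<le> R + 1" if "F x \<noteq> 0" for x
  proof (rule ccontr)
    assume x: "\<not> norm x \<le> R + 1"
    have "H x \<le> 0"
    proof (rule H_leI)
      fix e assume e: "e \<in> E"
      then have "norm e \<le> R" using R by auto
      then have "1 \<le> dist x e" using x norm_triangle_ineq2[of x e] by (simp add: dist_norm)
      then have "M * 1 \<le> M * dist x e" using \<open>M > 0\<close> by (intro mult_left_mono) auto
      then show "f e - M * dist x e \<le> 0" using f(2)[OF e] by simp
    qed
    then show False using that by (simp add: F_def)
  qed
  moreover have "E \<subseteq> cball 0 (R + 1)" using R by auto
  ultimately show ?thesis by blast
qed

lemma whitney_field_continuous:
  assumes "whitney_field E f b"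
  shows "continuous_on E b" and "continuous_on E f"
proof -
  show b: "continuous_on E b"
    unfolding continuous_on_iff
  proof (intro ballI allI impI)
    fix \<epsilon> :: real and x :: 'a assume "x \<in> E" "\<epsilon> > 0"
    then obtain \<delta> where "\<delta> > 0" "\<And>y. y \<in> E \<Longrightarrow> dist x y < \<delta> \<Longrightarrow> norm (b y - b x) \<le> \<epsilon> / 2"
      using assms unfolding whitney_field_def by (metis half_gt_zero)
    then show "\<exists>\<delta>>0. \<forall>y\<in>E. dist y x < \<delta> \<longrightarrow> dist (b y) (b x) < \<epsilon>"
      using \<open>\<epsilon> > 0\<close> by (intro exI[of _ \<delta>]) (fastforce simp: dist_norm norm_minus_commute)
  qed
  show "continuous_on E f"
    unfolding continuous_on_iff
  proof (intro ballI allI impI)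
    fix \<epsilon> :: real and x assume x: "x \<in> E" "\<epsilon> > 0"
    then obtain \<delta> where \<delta>: "\<delta> > 0"
      "\<And>y. y \<in> E \<Longrightarrow> dist x y < \<delta> \<Longrightarrow> \<bar>f y - f x - b x \<bullet> (y - x)\<bar> \<le> 1 * dist x y"
      using assms unfolding whitney_field_def by (metis zero_less_one)
    define K where "K = 1 + norm (b x)"
    have K: "K > 0" by (simp add: K_def add_pos_nonneg)
    show "\<exists>\<delta>>0. \<forall>y\<in>E. dist y x < \<delta> \<longrightarrow> dist (f y) (f x) < \<epsilon>"
    proof (intro exI[of _ "min \<delta> (\<epsilon> / K)"] conjI ballI impI)
      show "0 < min \<delta> (\<epsilon> / K)" using K \<delta> x by simp
      fix y assume y: "y \<in> E" "dist y x < min \<delta> (\<epsilon> / K)"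
      have "\<bar>b x \<bullet> (y - x)\<bar> \<le> norm (b x) * dist x y"
        using Cauchy_Schwarz_ineq2[of "b x" "y - x"] by (simp add: dist_norm norm_minus_commute)
      then have "\<bar>f y - f x\<bar> \<le> K * dist x y"
        using \<delta>(2)[of y] y by (simp add: dist_commute K_def algebra_simps)
      also have "\<dots> < \<epsilon>" using y K by (simp add: dist_commute field_simps)
      finally show "dist (f y) (f x) < \<epsilon>" by (simp add: dist_real_def)
    qed
  qed
qed

lemma whitney_field_bounded:
  assumes "compact E" "whitney_field E f b"
  shows "\<exists>M>0. field_bound E f b M"
proof -
  have "bounded (b ` E)" "bounded (f ` E)"
    using whitney_field_continuous[OF assms(2)] \<open>compact E\<close>
    by (auto intro!: compact_imp_bounded compact_continuous_image)
  then obtain A B where A: "\<And>x. x \<in> E \<Longrightarrow> \<bar>f x\<bar> \<le> A" and B: "\<And>x. x \<in> E \<Longrightarrow> norm (b x) \<le> B" "B > 0" "A > 0"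
    by (auto simp: bounded_pos)
  obtain \<delta> where \<delta>: "\<delta> > 0"
    "\<And>x y. x \<in> E \<Longrightarrow> y \<in> E \<Longrightarrow> dist x y < \<delta> \<Longrightarrow> \<bar>f y - f x - b x \<bullet> (y - x)\<bar> \<le> 1 * dist x y"
    using assms unfolding whitney_field_def by (metis zero_less_one)
  \<comment> \<open>A bounds the values, B the gradients, 1 + B the slopes at distances below
    \<delta>, and 2 A/\<delta> the slopes beyond.\<close>
  define M where "M = A + B + 1 + 2 * A / \<delta>"
  have M: "A \<le> M" "B \<le> M" "1 + B \<le> M" "2 * A / \<delta> \<le> M" "M > 0"
    using B \<delta> by (auto simp: M_def add_pos_pos)
  have "\<bar>f x - f y\<bar> \<le> M * dist x y" if "x \<in> E" "y \<in> E" for x y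
  proof (cases "dist x y < \<delta>")
    case True
    have "\<bar>b x \<bullet> (y - x)\<bar> \<le> B * dist x y"
      using Cauchy_Schwarz_ineq2[of "b x" "y - x"] mult_right_mono[OF B(1)[OF that(1)], of "dist x y"]
      by (simp add: dist_norm norm_minus_commute)
    then have "\<bar>f x - f y\<bar> \<le> (1 + B) * dist x y"
      using \<delta>(2)[OF that True] by (simp add: algebra_simps)
    also have "\<dots> \<le> M * dist x y" using M by (intro mult_right_mono) auto
    finally show ?thesis .
  next
    case False
    have "\<bar>f x - f y\<bar> \<le> 2 * A" using A[OF that(1)] A[OF that(2)] by linarith
    also have "\<dots> = 2 * A / \<delta> * \<delta>" using \<delta> by simp
    also have "\<dots> \<le> M * dist x y" using M False \<delta> B by (intro mult_mono) auto
    finally show ?thesis .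
  qed
  then show ?thesis
    using A B M unfolding field_bound_def
    by (intro exI[of _ M]) (smt (verit, best))
qed

text \<open>On the compact set where |b| >= \<eta> the function f has no zero, so it has a positive
  minimum there. The threshold \<tau> depends on the whole field, not only on its bounds.\<close>

lemma whitney_field_small_gradient:
  assumes "compact E" "whitney_field E f b" "\<eta> > 0"
  shows "\<exists>\<tau>>0. \<forall>x\<in>E. f x \<le> \<tau> \<longrightarrow> norm (b x) \<le> \<eta>"
proof -
  define K where "K = E \<inter> (\<lambda>x. norm (b x)) -` {\<eta>..}"
  have "closed K" unfolding K_def
    using whitney_field_continuous[OF assms(2)] compact_imp_closed[OF \<open>compact E\<close>]
    by (intro continuous_closed_preimage continuous_intros) auto
  then have "compact K"
    using compact_Int_closed[OF \<open>compact E\<close>, of K] by (simp add: K_def Int_absorb1)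
  show ?thesis
  proof (cases "K = {}")
    case True
    then show ?thesis by (intro exI[of _ 1]) (auto simp: K_def)
  next
    case False
    have "continuous_on K f"
      using whitney_field_continuous(2)[OF assms(2)] by (rule continuous_on_subset) (simp add: K_def)
    then obtain x0 where x0: "x0 \<in> K" "\<And>x. x \<in> K \<Longrightarrow> f x0 \<le> f x"
      using continuous_attains_inf[OF \<open>compact K\<close> False] by blast
    have "f x0 \<noteq> 0" "0 \<le> f x0"
      using x0(1) \<open>\<eta> > 0\<close> assms(2) by (auto simp: K_def whitney_field_def)
    then have pos: "f x0 > 0" by simp
    have "norm (b x) \<le> \<eta>" if "x \<in> E" "f x \<le> f x0 / 2" for x
    proof (rule ccontr)
      assume "\<not> norm (b x) \<le> \<eta>"
      then have "x \<in> K" using that by (simp add: K_def)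
      from x0(2)[OF this] show False using that pos by simp
    qed
    with pos show ?thesis by (intro exI[of _ "f x0 / 2"]) auto
  qed
qed

section \<open>One approximation step at a fine scale\<close>

definition nonneg_C1_bounded :: "real \<Rightarrow> ('a::euclidean_space \<Rightarrow> real) \<Rightarrow> ('a \<Rightarrow> 'a) \<Rightarrow> bool" where
  "nonneg_C1_bounded N G g \<longleftrightarrow>
     continuous_on UNIV g \<and> (\<forall>x. (G has_derivative (\<lambda>h. g x \<bullet> h)) (at x)) \<and>
     (\<forall>x. 0 \<le> G x \<and> G x \<le> N \<and> norm (g x) \<le> N)"

text \<open>
  The approximation glues affine pieces \<open>P z\<close>, taken from the field at a nearby point of \<open>E\<close>. Lowering
  them by \<open>9 * (\<eta> * \<delta>)\<close> keeps the residual nonnegative. Where the value is at most \<open>\<tau>\<close> the slope is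
  replaced by 0, which keeps the pieces themselves nonnegative and costs little because the
  gradient of a field is small where its value is small. Away from \<open>E\<close> the pieces come from a
  Lipschitz extension \<open>F\<close> of \<open>f\<close>, so that neighbouring pieces always differ by \<open>O(M * \<delta>)\<close> and
  the constant \<open>C\<close> is independent of the scale \<open>\<delta>\<close>.
\<close>

lemma nonneg_field_approximation:
  "\<exists>C>0. \<forall>(E :: 'a::euclidean_space set) f b M \<epsilon>.
     compact E \<longrightarrow> whitney_field E f b \<longrightarrow> field_bound E f b M \<longrightarrow> M > 0 \<longrightarrow> \<epsilon> > 0 \<longrightarrow>
     (\<exists>G g. nonneg_C1_bounded (C * M) G g \<and>
        whitney_field E (\<lambda>x. f x - G x) (\<lambda>x. b x - g x) \<and>
        field_bound E (\<lambda>x. f x - G x) (\<lambda>x. b x - g x) \<epsilon>)"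
proof -
  obtain K where "K \<ge> 0" and K: "\<And>\<delta> R. \<delta> > 0 \<Longrightarrow>
      \<exists>(S :: ('a \<Rightarrow> int) set) (p :: _ \<Rightarrow> 'a) \<phi>. C1_partition K \<delta> R S p \<phi>"
    using partition_of_unity_lattice[where 'a = 'a] by blast
  \<comment> \<open>G is at most F plus 17 M \<delta>, hence at most 18 M; its gradient is at most
    (1 + 17 K) M. C covers both.\<close>
  define C where "C = 18 + 17 * K"
  have "C > 0" using \<open>K \<ge> 0\<close> by (simp add: C_def)
  have main: "\<exists>G g. nonneg_C1_bounded (C * M) G g \<and>
        whitney_field E (\<lambda>x. f x - G x) (\<lambda>x. b x - g x) \<and>
        field_bound E (\<lambda>x. f x - G x) (\<lambda>x. b x - g x) \<epsilon>"
    if "compact E" and wf: "whitney_field E f b" and fb: "field_bound E f b M" and "M > 0" and "\<epsilon> > 0"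
    for E :: "'a set" and f b M \<epsilon>
  proof (cases "E = {}")
    case True
    then show ?thesis using \<open>M > 0\<close> \<open>C > 0\<close>
      by (intro exI[of _ "\<lambda>x. 0"]) (auto simp: whitney_field_def field_bound_def nonneg_C1_bounded_def)
  next
    case False
    have f0: "0 \<le> f x" "f x = 0 \<Longrightarrow> b x = 0" if "x \<in> E" for x
      using wf that by (auto simp: whitney_field_def)
    have fM: "f x \<le> M" "norm (b x) \<le> M" if "x \<in> E" for x
      using fb that by (auto simp: field_bound_def)
    have fLip: "\<bar>f x - f y\<bar> \<le> M * dist x y" if "x \<in> E" "y \<in> E" for x y
      using fb that by (auto simp: field_bound_def)
    obtain F R where R: "E \<subseteq> cball 0 R" and Ff: "\<And>x. x \<in> E \<Longrightarrow> F x = f x"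
      and F: "\<And>x. 0 \<le> F x" "\<And>x. F x \<le> M"
      and FLip: "\<And>x y. \<bar>F x - F y\<bar> \<le> M * dist x y" and Fsupp: "\<And>x. F x \<noteq> 0 \<Longrightarrow> norm x \<le> R"
      using Lipschitz_extension_compact_support[OF \<open>compact E\<close> False \<open>M > 0\<close> f0(1) fM(1) fLip] by metis
    \<comment> \<open>37 + 17 K = (3 + 17 K) + 34: the bracket is for the Lipschitz constant of the
      residual at distances up to \<delta>, the 34 for larger distances. The cap at M lets \<eta>
      \<delta> be absorbed into M \<delta>.\<close>
    define \<eta> where "\<eta> = min M (\<epsilon> / (37 + 17 * K))"
    have K37: "37 + 17 * K > 0" using \<open>K \<ge> 0\<close> by simp
    have \<eta>: "\<eta> > 0" "\<eta> \<le> M" using \<open>M > 0\<close> \<open>\<epsilon> > 0\<close> K37 by (auto simp: \<eta>_def)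
    have "\<eta> \<le> \<epsilon> / (37 + 17 * K)" by (simp add: \<eta>_def)
    then have \<eta>\<epsilon>: "(37 + 17 * K) * \<eta> \<le> \<epsilon>" using K37 by (simp add: pos_le_divide_eq mult.commute)
    obtain \<delta>0 where "\<delta>0 > 0" and \<delta>0: "\<And>x y. x \<in> E \<Longrightarrow> y \<in> E \<Longrightarrow> dist x y < \<delta>0 \<Longrightarrow>
        \<bar>f y - f x - b x \<bullet> (y - x)\<bar> \<le> \<eta> * dist x y \<and> norm (b y - b x) \<le> \<eta>"
      using wf \<eta>(1) unfolding whitney_field_def by metis
    obtain \<tau> where "\<tau> > 0" and \<tau>: "\<And>x. x \<in> E \<Longrightarrow> f x \<le> \<tau> \<Longrightarrow> norm (b x) \<le> \<eta>"
      using whitney_field_small_gradient[OF \<open>compact E\<close> wf \<eta>(1)] by blast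
    \<comment> \<open>The bound 1 keeps the \<delta>-neighbourhood of the support of
      \<open>F\<close> inside the ball of radius R + 1, where the weights sum to 1. The bound by
      \<delta>0 / 5 makes 4 \<delta> < \<delta>0, where 4 \<delta> is 2 \<delta> from a point in
      play to \<open>p z\<close> and 2 \<delta> from there to \<open>ct z\<close>. Finally 13 = 9 +
      4: a base value above \<tau> survives the lowering by 9 \<eta> \<delta> and a slope M over
      distance 4 \<delta>.\<close>
    define \<delta> where "\<delta> = min 1 (min (\<delta>0 / 5) (\<tau> / (13 * M)))"
    have \<delta>: "\<delta> > 0" "\<delta> \<le> 1" "4 * \<delta> < \<delta>0" "13 * M * \<delta> \<le> \<tau>"
    proof -
      show "\<delta> > 0" "\<delta> \<le> 1" using \<open>\<delta>0 > 0\<close> \<open>\<tau> > 0\<close> \<open>M > 0\<close> by (auto simp: \<delta>_def)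
      have "\<delta> \<le> \<delta>0 / 5" "\<delta> \<le> \<tau> / (13 * M)" by (auto simp: \<delta>_def)
      then show "4 * \<delta> < \<delta>0" "13 * M * \<delta> \<le> \<tau>"
        using \<open>\<delta>0 > 0\<close> \<open>M > 0\<close> by (auto simp: field_simps)
    qed
    have \<eta>\<delta>: "\<eta> * \<delta> \<le> M * \<delta>" "0 < \<eta> * \<delta>" "0 < M * \<delta>"
      using \<eta> \<delta> \<open>M > 0\<close> by auto
    obtain S :: "('a \<Rightarrow> int) set" and p :: "('a \<Rightarrow> int) \<Rightarrow> 'a" and \<phi>
      where part: "C1_partition K \<delta> (R + 1) S p \<phi>"
      using K[OF \<delta>(1)] by blast
    have "finite S" and C1: "\<And>z. z \<in> S \<Longrightarrow> C1_fun (\<phi> z)"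
      and \<phi>0: "\<And>z x. 0 \<le> \<phi> z x" and supp: "\<And>z x. z \<in> S \<Longrightarrow> \<phi> z x \<noteq> 0 \<Longrightarrow> dist x (p z) \<le> \<delta>"
      and le1: "\<And>x. (\<Sum>z\<in>S. \<phi> z x) \<le> 1" and eq1: "\<And>x. norm x \<le> R + 1 \<Longrightarrow> (\<Sum>z\<in>S. \<phi> z x) = 1"
      and \<phi>Lip: "\<And>x y. (\<Sum>z\<in>S. \<bar>\<phi> z x - \<phi> z y\<bar>) \<le> K / \<delta> * dist x y"
      using part unfolding C1_partition_def by blast+
    \<comment> \<open>Choice of base points. If x in E is within \<delta> of the support of
      \<open>\<phi> z\<close>, it is within 2 \<delta> of \<open>p z\<close>, so every piece that
      matters near E is based in E. The other pieces are constants taken from \<open>F\<close> at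
      the lattice point.\<close>
    have "\<forall>z. \<exists>c. if \<exists>e\<in>E. dist e (p z) \<le> 2 * \<delta> then c \<in> E \<and> dist c (p z) \<le> 2 * \<delta> else c = p z"
      by auto
    then obtain ct where ct: "\<And>z. if \<exists>e\<in>E. dist e (p z) \<le> 2 * \<delta>
        then ct z \<in> E \<and> dist (ct z) (p z) \<le> 2 * \<delta> else ct z = p z"
      by metis
    have ct_near: "dist (ct z) (p z) \<le> 2 * \<delta>" for z
      using ct[of z] \<delta>(1) by (auto split: if_splits)
    have ct_E: "ct z \<in> E" if "x \<in> E" "dist x (p z) \<le> 2 * \<delta>" for z x
      using ct[of z] that by (auto split: if_splits)
    \<comment> \<open>At points of E near \<open>p z\<close>, the Taylor remainder and the discarded
      slope each cost at most \<eta> * 4 \<delta>; lowering by 9 rather than 8 makes the piece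
      strictly smaller than f unless it is cut off at 0.\<close>
    define a where "a = (\<lambda>z. max 0 (F (ct z) - 9 * (\<eta> * \<delta>)))"
    define B where "B = (\<lambda>z. if ct z \<in> E \<and> F (ct z) > \<tau> then b (ct z) else 0)"
    define P where "P = (\<lambda>z y. a z + B z \<bullet> (y - ct z))"
    have a: "0 \<le> a z" "a z \<le> F (ct z)" "F (ct z) - a z \<le> 9 * (\<eta> * \<delta>)" for z
      using F(1)[of "ct z"] \<eta>\<delta> by (auto simp: a_def)
    have BM: "norm (B z) \<le> M" for z using fM \<open>M > 0\<close> by (auto simp: B_def)
    have inner_le: "\<bar>v \<bullet> (y - x)\<bar> \<le> c * dist x y" if "norm v \<le> c" for v x y :: 'a and c
      using Cauchy_Schwarz_ineq2[of v "y - x"] mult_right_mono[OF that, of "dist x y"]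
      by (simp add: dist_norm norm_minus_commute)
    have near: "dist (ct z) y \<le> 4 * \<delta>" if "dist y (p z) \<le> 2 * \<delta>" for y z
      using dist_triangle2[of "ct z" y "p z"] ct_near[of z] that by linarith
    have Pinner: "\<bar>B z \<bullet> (y - ct z)\<bar> \<le> 4 * (M * \<delta>)" if "dist y (p z) \<le> 2 * \<delta>" for y z
    proof -
      have "\<bar>B z \<bullet> (y - ct z)\<bar> \<le> M * dist (ct z) y" using inner_le[OF BM] .
      also have "\<dots> \<le> M * (4 * \<delta>)" using near[OF that] \<open>M > 0\<close> by (intro mult_left_mono) auto
      finally show ?thesis by simp
    qed
    have P0: "0 \<le> P z y" if "dist y (p z) \<le> 2 * \<delta>" for y z
    proof (cases "B z = 0")
      case True
      then show ?thesis using a(1) by (simp add: P_def)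
    next
      case False
      then have "F (ct z) > \<tau>" by (auto simp: B_def split: if_splits)
      then have "a z \<ge> 4 * (M * \<delta>)" using \<delta>(4) \<eta>\<delta> a(3)[of z] by linarith
      then show ?thesis using Pinner[OF that] by (simp add: P_def)
    qed
    \<comment> \<open>17 = 4 + 4 + 9: variation of \<open>F\<close>, of the affine piece, and the
      lowering. In \<open>Pf\<close> below, Taylor remainder and discarded slope take the place of
      the two 4s, now with \<eta> instead of M.\<close>
    have PF: "\<bar>P z y - F y\<bar> \<le> 17 * (M * \<delta>)" if "dist y (p z) \<le> 2 * \<delta>" for y z
    proof -
      have "M * dist (ct z) y \<le> M * (4 * \<delta>)" using near[OF that] \<open>M > 0\<close> by (intro mult_left_mono) auto
      then have "\<bar>F (ct z) - F y\<bar> \<le> 4 * (M * \<delta>)" using FLip[of "ct z" y] by simp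
      then show ?thesis using Pinner[OF that] a[of z] \<eta>\<delta> unfolding P_def by linarith
    qed
    have Bb: "norm (B z - b x) \<le> 2 * \<eta>" and Pf: "\<bar>P z x - f x\<bar> \<le> 17 * (\<eta> * \<delta>)"
      and Pless: "f x > 0 \<Longrightarrow> P z x < f x" and Ple: "P z x \<le> f x"
      if x: "x \<in> E" "dist x (p z) \<le> 2 * \<delta>" for x z
    proof -
      have e: "ct z \<in> E" using ct_E x by blast
      have d: "dist (ct z) x < \<delta>0" "dist (ct z) x \<le> 4 * \<delta>" using near[OF x(2)] \<delta> by auto
      have "\<eta> * dist (ct z) x \<le> \<eta> * (4 * \<delta>)" using d \<eta> by (intro mult_left_mono) auto
      then have t: "\<bar>f x - f (ct z) - b (ct z) \<bullet> (x - ct z)\<bar> \<le> 4 * (\<eta> * \<delta>)"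
        and bb: "norm (b x - b (ct z)) \<le> \<eta>" using \<delta>0[OF e x(1) d(1)] by auto
      \<comment> \<open>Either the slope is kept, or the base value is at most \<tau> and the slope
        replaced by 0 was at most \<eta>.\<close>
      have Be: "norm (B z - b (ct z)) \<le> \<eta>" using \<tau>[OF e] \<eta> e Ff[OF e] by (auto simp: B_def)
      show "norm (B z - b x) \<le> 2 * \<eta>"
        using norm_triangle_ineq4[of "B z - b (ct z)" "b x - b (ct z)"] bb Be by simp
      have "\<bar>(B z - b (ct z)) \<bullet> (x - ct z)\<bar> \<le> \<eta> * dist (ct z) x" using inner_le[OF Be] .
      also have "\<dots> \<le> \<eta> * (4 * \<delta>)" using d \<eta> by (intro mult_left_mono) auto
      finally have i: "\<bar>B z \<bullet> (x - ct z) - b (ct z) \<bullet> (x - ct z)\<bar> \<le> 4 * (\<eta> * \<delta>)"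
        by (simp add: inner_diff_left)
      show "\<bar>P z x - f x\<bar> \<le> 17 * (\<eta> * \<delta>)"
        using t i a[of z] Ff[OF e] \<eta>\<delta> unfolding P_def by linarith
      \<comment> \<open>The alternative P = 0 arises when the base value is cut off: it is then
        below 9 \<eta> \<delta> < \<tau>, so the slope is 0 as well. In both cases the piece is
        strictly below a positive f x.\<close>
      have "P z x < f x \<or> P z x = 0"
      proof (cases "F (ct z) \<ge> 9 * (\<eta> * \<delta>)")
        case True
        then have "a z = f (ct z) - 9 * (\<eta> * \<delta>)" using Ff[OF e] by (simp add: a_def)
        then show ?thesis using t i \<eta>\<delta> unfolding P_def by linarith
      next
        case False
        then have "a z = 0" by (simp add: a_def)
        moreover have "B z = 0" using False \<delta>(4) \<eta>\<delta> by (auto simp: B_def)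
        ultimately show ?thesis by (simp add: P_def)
      qed
      then show "P z x \<le> f x" "f x > 0 \<Longrightarrow> P z x < f x" using f0(1)[OF x(1)] by auto
    qed
    define G where "G = (\<lambda>y. \<Sum>z\<in>S. \<phi> z y * P z y)"
    have "C1_fun G"
      unfolding G_def P_def by (intro C1_fun_sum C1_fun_mult C1 C1_fun_affine)
    then obtain g where gc: "continuous_on UNIV g" and gd: "\<And>x. (G has_derivative (\<lambda>h. g x \<bullet> h)) (at x)"
      unfolding C1_fun_def by blast
    have supp2: "dist x (p z) \<le> 2 * \<delta>" if "z \<in> S" "dist x y \<le> \<delta>" "\<phi> z x \<noteq> 0 \<or> \<phi> z y \<noteq> 0" for x y z
      using supp[OF that(1), of x] supp[OF that(1), of y] that dist_triangle[of x "p z" y] \<delta>(1) by auto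
    have suppx: "dist x (p z) \<le> 2 * \<delta>" if "z \<in> S" "\<phi> z x \<noteq> 0" for x z
      using supp[OF that] \<delta>(1) by simp
    have G0: "0 \<le> G x" for x
      unfolding G_def
    proof (rule sum_nonneg)
      fix z assume "z \<in> S"
      then show "0 \<le> \<phi> z x * P z x" using \<phi>0[of z x] P0[OF suppx, of z x] by (cases "\<phi> z x = 0") auto
    qed
    have average: "(\<Sum>z\<in>S. \<phi> z x * u z) \<le> c" if "c \<ge> 0" "\<And>z. z \<in> S \<Longrightarrow> \<phi> z x \<noteq> 0 \<Longrightarrow> u z \<le> c" for x u c
    proof -
      have "(\<Sum>z\<in>S. \<phi> z x * u z) \<le> (\<Sum>z\<in>S. \<phi> z x * c)"
      proof (rule sum_mono)
        fix z assume "z \<in> S"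
        then show "\<phi> z x * u z \<le> \<phi> z x * c"
          using \<phi>0[of z x] that(2)[of z] by (cases "\<phi> z x = 0") (auto intro: mult_left_mono)
      qed
      also have "\<dots> = (\<Sum>z\<in>S. \<phi> z x) * c" by (simp add: sum_distrib_right)
      also have "\<dots> \<le> 1 * c" using le1 that(1) by (intro mult_right_mono) auto
      finally show ?thesis by simp
    qed
    \<comment> \<open>Differences between pieces are of order \<delta>, which cancels the 1/\<delta>
      in the Lipschitz bound of the partition. This makes the final constants independent of the
      scale.\<close>
    have oscillation: "\<bar>\<Sum>z\<in>S. (\<phi> z y - \<phi> z x) * u z\<bar> \<le> K * c * dist x y"
      if "dist x y \<le> \<delta>" "\<And>z. z \<in> S \<Longrightarrow> dist x (p z) \<le> 2 * \<delta> \<Longrightarrow> \<bar>u z\<bar> \<le> c * \<delta>" "c \<ge> 0" for x y u c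
    proof -
      have "\<bar>\<Sum>z\<in>S. (\<phi> z y - \<phi> z x) * u z\<bar> \<le> (\<Sum>z\<in>S. \<bar>\<phi> z y - \<phi> z x\<bar> * \<bar>u z\<bar>)"
        unfolding abs_mult[symmetric] by (rule sum_abs)
      also have "\<dots> \<le> (\<Sum>z\<in>S. \<bar>\<phi> z y - \<phi> z x\<bar> * (c * \<delta>))"
      proof (rule sum_mono)
        fix z assume z: "z \<in> S"
        show "\<bar>\<phi> z y - \<phi> z x\<bar> * \<bar>u z\<bar> \<le> \<bar>\<phi> z y - \<phi> z x\<bar> * (c * \<delta>)"
        proof (cases "\<phi> z x \<noteq> 0 \<or> \<phi> z y \<noteq> 0")
          case True
          then show ?thesis using that(2)[OF z supp2[OF z that(1) True]] by (intro mult_left_mono) auto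
        qed simp
      qed
      also have "\<dots> = (\<Sum>z\<in>S. \<bar>\<phi> z y - \<phi> z x\<bar>) * (c * \<delta>)" by (simp add: sum_distrib_right)
      also have "\<dots> \<le> (K / \<delta> * dist y x) * (c * \<delta>)"
        using \<phi>Lip[of y x] that(3) \<delta>(1) by (intro mult_right_mono) auto
      also have "\<dots> = K * c * dist x y" using \<delta>(1) by (simp add: dist_commute)
      finally show ?thesis .
    qed
    have GM: "G x \<le> C * M" for x
    proof -
      have "G x \<le> 18 * M" unfolding G_def
      proof (rule average)
        fix z assume "z \<in> S" "\<phi> z x \<noteq> 0"
        then have "\<bar>P z x - F x\<bar> \<le> 17 * (M * \<delta>)" using PF suppx by blast
        moreover have "M * \<delta> \<le> M * 1" using \<delta> \<open>M > 0\<close> by (intro mult_left_mono) auto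
        ultimately show "P z x \<le> 18 * M" using F(2)[of x] by linarith
      qed (use \<open>M > 0\<close> in simp)
      also have "\<dots> \<le> C * M" using \<open>M > 0\<close> \<open>K \<ge> 0\<close> by (intro mult_right_mono) (auto simp: C_def)
      finally show ?thesis .
    qed
    have GLip: "\<bar>G y - G x\<bar> \<le> C * M * dist x y" if xy: "dist x y \<le> \<delta>" for x y
    proof -
      \<comment> \<open>Away from the ball of radius R + 1 the weights need not sum to 1, but
        \<open>F\<close> vanishes outside the ball of radius R.\<close>
      have sums: "F x * ((\<Sum>z\<in>S. \<phi> z y) - (\<Sum>z\<in>S. \<phi> z x)) = 0"
      proof (cases "F x = 0")
        case False
        then have "norm x \<le> R" by (rule Fsupp)
        moreover have "norm y \<le> norm x + dist x y"
          using norm_triangle_ineq2[of y x] by (simp add: dist_norm norm_minus_commute)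
        ultimately show ?thesis using eq1[of x] eq1[of y] xy \<delta>(2) by simp
      qed simp
      \<comment> \<open>A discrete product rule: the pieces vary in the first sum, the weights in
        the second. Subtracting F x, common to all pieces, leaves differences of order
        \<delta>.\<close>
      have "G y - G x = (\<Sum>z\<in>S. \<phi> z y * (B z \<bullet> (y - x))) + (\<Sum>z\<in>S. (\<phi> z y - \<phi> z x) * (P z x - F x))
          + F x * ((\<Sum>z\<in>S. \<phi> z y) - (\<Sum>z\<in>S. \<phi> z x))"
        unfolding G_def P_def
        by (simp add: sum_distrib_left sum_subtractf[symmetric] sum.distrib[symmetric] inner_diff_right algebra_simps)
      moreover have "\<bar>\<Sum>z\<in>S. \<phi> z y * (B z \<bullet> (y - x))\<bar> \<le> M * dist x y"
      proof (rule abs_leI)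
        show "(\<Sum>z\<in>S. \<phi> z y * (B z \<bullet> (y - x))) \<le> M * dist x y"
          using inner_le[OF BM, of _ y x] \<open>M > 0\<close> by (intro average) (auto simp: abs_le_iff)
        have "(\<Sum>z\<in>S. \<phi> z y * (- (B z \<bullet> (y - x)))) \<le> M * dist x y"
          using inner_le[OF BM, of _ y x] \<open>M > 0\<close> by (intro average) (auto simp: abs_le_iff)
        then show "- (\<Sum>z\<in>S. \<phi> z y * (B z \<bullet> (y - x))) \<le> M * dist x y" by (simp add: sum_negf)
      qed
      moreover have "\<bar>\<Sum>z\<in>S. (\<phi> z y - \<phi> z x) * (P z x - F x)\<bar> \<le> K * (17 * M) * dist x y"
        using PF[of x] \<open>M > 0\<close> by (intro oscillation[OF xy]) (auto simp: mult.assoc)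
      ultimately have "\<bar>G y - G x\<bar> \<le> M * dist x y + K * (17 * M) * dist x y" using sums by linarith
      also have "\<dots> = (1 + 17 * K) * M * dist x y" by (simp add: algebra_simps)
      also have "\<dots> \<le> C * M * dist x y" using \<open>M > 0\<close> by (intro mult_right_mono) (auto simp: C_def)
      finally show ?thesis .
    qed
    have gM: "norm (g x) \<le> C * M" for x
      using gradient_norm_le[OF gd \<delta>(1), where b = 0 and K = "C * M"] GLip by simp
    define \<kappa> where "\<kappa> = 2 * \<eta> + K * (17 * \<eta>)"
    have \<kappa>: "\<kappa> + \<eta> \<le> \<epsilon>" "\<kappa> \<le> \<epsilon>" "34 * \<eta> \<le> \<epsilon>" "17 * \<eta> \<le> \<epsilon>"
      using \<eta> \<eta>\<epsilon> mult_nonneg_nonneg[OF \<open>K \<ge> 0\<close>, of \<eta>] by (auto simp: \<kappa>_def algebra_simps)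
    \<comment> \<open>y runs through a full ball around x, not only through E, because
      \<open>gradient_norm_le\<close> is to compare the gradient of G at x with
      \<open>b x\<close>.\<close>
    have Gjet: "\<bar>G y - G x - b x \<bullet> (y - x)\<bar> \<le> \<kappa> * dist x y" if x: "x \<in> E" and xy: "dist x y \<le> \<delta>" for x y
    proof -
      have "norm x \<le> R" using R x by auto
      moreover have "norm y \<le> norm x + dist x y"
        using norm_triangle_ineq2[of y x] by (simp add: dist_norm norm_minus_commute)
      ultimately have one: "(\<Sum>z\<in>S. \<phi> z x) = 1" "(\<Sum>z\<in>S. \<phi> z y) = 1" using eq1[of x] eq1[of y] xy \<delta>(2) by auto
      have "G y - G x = (\<Sum>z\<in>S. \<phi> z y * ((B z - b x) \<bullet> (y - x))) + (\<Sum>z\<in>S. (\<phi> z y - \<phi> z x) * (P z x - f x))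
          + f x * ((\<Sum>z\<in>S. \<phi> z y) - (\<Sum>z\<in>S. \<phi> z x)) + (b x \<bullet> (y - x)) * (\<Sum>z\<in>S. \<phi> z y)"
        unfolding G_def P_def
        by (simp add: sum_distrib_left sum_subtractf[symmetric] sum.distrib[symmetric] inner_diff_right
            inner_diff_left algebra_simps)
      then have "G y - G x - b x \<bullet> (y - x) = (\<Sum>z\<in>S. \<phi> z y * ((B z - b x) \<bullet> (y - x)))
          + (\<Sum>z\<in>S. (\<phi> z y - \<phi> z x) * (P z x - f x))"
        by (simp add: one)
      moreover have Bb': "\<bar>(B z - b x) \<bullet> (y - x)\<bar> \<le> 2 * \<eta> * dist x y" if "z \<in> S" "\<phi> z y \<noteq> 0" for z
        using Bb[OF x supp2[OF that(1) xy]] that by (intro inner_le) auto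
      have "\<bar>\<Sum>z\<in>S. \<phi> z y * ((B z - b x) \<bullet> (y - x))\<bar> \<le> 2 * \<eta> * dist x y"
      proof (rule abs_leI)
        show "(\<Sum>z\<in>S. \<phi> z y * ((B z - b x) \<bullet> (y - x))) \<le> 2 * \<eta> * dist x y"
          using Bb' \<eta> by (intro average) (auto simp: abs_le_iff)
        have "(\<Sum>z\<in>S. \<phi> z y * (- ((B z - b x) \<bullet> (y - x)))) \<le> 2 * \<eta> * dist x y"
          using Bb' \<eta> by (intro average) (auto simp: abs_le_iff)
        then show "- (\<Sum>z\<in>S. \<phi> z y * ((B z - b x) \<bullet> (y - x))) \<le> 2 * \<eta> * dist x y" by (simp add: sum_negf)
      qed
      moreover have "\<bar>\<Sum>z\<in>S. (\<phi> z y - \<phi> z x) * (P z x - f x)\<bar> \<le> K * (17 * \<eta>) * dist x y"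
        using Pf[OF x] \<eta> by (intro oscillation[OF xy]) (auto simp: mult.assoc)
      ultimately have "\<bar>G y - G x - b x \<bullet> (y - x)\<bar> \<le> 2 * \<eta> * dist x y + K * (17 * \<eta>) * dist x y" by linarith
      then show ?thesis by (simp add: \<kappa>_def algebra_simps)
    qed
    have gb: "norm (b x - g x) \<le> \<epsilon>" if "x \<in> E" for x
      using gradient_norm_le[OF gd \<delta>(1) Gjet[OF that]] \<kappa> by (simp add: norm_minus_commute)
    have fG: "f x - G x = (\<Sum>z\<in>S. \<phi> z x * (f x - P z x))" if "x \<in> E" for x
    proof -
      have "(\<Sum>z\<in>S. \<phi> z x) = 1" using R that by (intro eq1) auto
      then have "f x - G x = f x * (\<Sum>z\<in>S. \<phi> z x) - G x" by simp
      also have "\<dots> = (\<Sum>z\<in>S. \<phi> z x * (f x - P z x))"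
        unfolding G_def by (simp add: sum_distrib_left sum_subtractf[symmetric] algebra_simps)
      finally show ?thesis .
    qed
    have r_le: "f x - G x \<le> 17 * (\<eta> * \<delta>)" if "x \<in> E" for x
      unfolding fG[OF that] using Pf[OF that suppx] \<eta>\<delta> by (intro average) (auto simp: abs_le_iff)
    have r_nonneg: "0 \<le> f x - G x" if "x \<in> E" for x
      unfolding fG[OF that]
    proof (rule sum_nonneg)
      fix z assume "z \<in> S"
      then show "0 \<le> \<phi> z x * (f x - P z x)"
        using \<phi>0[of z x] Ple[OF that suppx, of z] by (cases "\<phi> z x = 0") auto
    qed
    \<comment> \<open>If f x were positive, some weight would be positive with its piece strictly
      below f x, and the residual would not vanish. So f x = 0, hence G x = 0 is a minimum of G, and
      both gradients are 0.\<close>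
    have r_zero: "b x - g x = 0" if x: "x \<in> E" and r: "f x - G x = 0" for x
    proof -
      have "f x = 0"
      proof (rule ccontr)
        assume "f x \<noteq> 0"
        then have "f x > 0" using f0(1)[OF x] by simp
        have "(\<Sum>z\<in>S. \<phi> z x) = 1" using R x by (intro eq1) auto
        then obtain z0 where z0: "z0 \<in> S" "\<phi> z0 x \<noteq> 0" by (metis sum.neutral zero_neq_one)
        have "0 < (\<Sum>z\<in>S. \<phi> z x * (f x - P z x))"
        proof (rule sum_pos2[OF \<open>finite S\<close> z0(1)])
          show "0 < \<phi> z0 x * (f x - P z0 x)"
            using z0 \<phi>0[of z0 x] Pless[OF x suppx[OF z0] \<open>f x > 0\<close>] by simp
          fix z assume "z \<in> S"
          then show "0 \<le> \<phi> z x * (f x - P z x)"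
            using \<phi>0[of z x] Ple[OF x suppx, of z] by (cases "\<phi> z x = 0") auto
        qed
        then show False using r fG[OF x] by simp
      qed
      moreover have "g x = 0"
      proof -
        have "G x = 0" using \<open>f x = 0\<close> r by simp
        then have "(\<lambda>h. g x \<bullet> h) = (\<lambda>h. 0)"
          using G0 by (intro has_derivative_local_min[OF gd]) (simp add: always_eventually)
        then show ?thesis by (metis inner_eq_zero_iff)
      qed
      ultimately show ?thesis using f0(2)[OF x] by simp
    qed
    have wf': "whitney_field E (\<lambda>x. f x - G x) (\<lambda>x. b x - g x)"
      unfolding whitney_field_def
    proof (intro conjI ballI allI impI)
      fix \<theta> :: real assume "\<theta> > 0"
      then have "\<theta> / 2 > 0" by simp
      obtain \<delta>1 where \<delta>1: "\<delta>1 > 0" "\<And>x y. x \<in> E \<Longrightarrow> y \<in> E \<Longrightarrow> dist x y < \<delta>1 \<Longrightarrow>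
          \<bar>f y - f x - b x \<bullet> (y - x)\<bar> \<le> \<theta> / 2 * dist x y \<and> norm (b y - b x) \<le> \<theta> / 2"
        using wf \<open>\<theta> / 2 > 0\<close> unfolding whitney_field_def by metis
      obtain \<delta>2 where \<delta>2: "\<delta>2 > 0" "\<And>x y. x \<in> E \<Longrightarrow> y \<in> E \<Longrightarrow> dist x y < \<delta>2 \<Longrightarrow>
          \<bar>G y - G x - g x \<bullet> (y - x)\<bar> \<le> \<theta> / 2 * dist x y \<and> norm (g y - g x) \<le> \<theta> / 2"
        using C1_uniform_taylor[OF gc gd \<open>compact E\<close> \<open>\<theta> / 2 > 0\<close>] by metis
      show "\<exists>\<delta>>0. \<forall>x\<in>E. \<forall>y\<in>E. dist x y < \<delta> \<longrightarrow>
          \<bar>f y - G y - (f x - G x) - (b x - g x) \<bullet> (y - x)\<bar> \<le> \<theta> * dist x y \<and>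
          norm (b y - g y - (b x - g x)) \<le> \<theta>"
      proof (intro exI[of _ "min \<delta>1 \<delta>2"] conjI ballI impI)
        show "0 < min \<delta>1 \<delta>2" using \<delta>1 \<delta>2 by simp
        fix x y assume xy: "x \<in> E" "y \<in> E" "dist x y < min \<delta>1 \<delta>2"
        have "\<bar>f y - f x - b x \<bullet> (y - x)\<bar> \<le> \<theta> / 2 * dist x y" "norm (b y - b x) \<le> \<theta> / 2"
          "\<bar>G y - G x - g x \<bullet> (y - x)\<bar> \<le> \<theta> / 2 * dist x y" "norm (g y - g x) \<le> \<theta> / 2"
          using \<delta>1(2)[of x y] \<delta>2(2)[of x y] xy by auto
        note * = this
        show "\<bar>f y - G y - (f x - G x) - (b x - g x) \<bullet> (y - x)\<bar> \<le> \<theta> * dist x y"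
        proof -
          have "\<theta> / 2 * dist x y = \<theta> * dist x y / 2" by simp
          then show ?thesis using *(1) *(3) unfolding inner_diff_left by linarith
        qed
        show "norm (b y - g y - (b x - g x)) \<le> \<theta>"
          using norm_triangle_ineq4[of "b y - b x" "g y - g x"] *(2) *(4) by (simp add: algebra_simps)
      qed
    qed (use r_nonneg r_zero in auto)
    have fb': "field_bound E (\<lambda>x. f x - G x) (\<lambda>x. b x - g x) \<epsilon>"
      unfolding field_bound_def
    proof (intro ballI conjI)
      fix x assume x: "x \<in> E"
      have "17 * (\<eta> * \<delta>) \<le> 17 * (\<eta> * 1)" using \<eta> \<delta> by (intro mult_left_mono) auto
      then show "f x - G x \<le> \<epsilon>" using r_le[OF x] \<kappa> by linarith
      show "norm (b x - g x) \<le> \<epsilon>" using gb[OF x] .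
      fix y assume y: "y \<in> E"
      show "\<bar>f x - G x - (f y - G y)\<bar> \<le> \<epsilon> * dist x y"
      proof (cases "dist x y \<le> \<delta>")
        case True
        have "\<bar>f y - f x - b x \<bullet> (y - x)\<bar> \<le> \<eta> * dist x y"
          using \<delta>0[OF x y] True \<delta> by auto
        with Gjet[OF x True] have "\<bar>f x - G x - (f y - G y)\<bar> \<le> (\<kappa> + \<eta>) * dist x y"
          unfolding distrib_right by linarith
        also have "\<dots> \<le> \<epsilon> * dist x y" using \<kappa> by (intro mult_right_mono) auto
        finally show ?thesis .
      next
        case False
        \<comment> \<open>Beyond distance \<delta> the size of the residual alone, at most 17 \<eta>
          \<delta> at either point, gives the Lipschitz bound.\<close>
        have "\<bar>f x - G x - (f y - G y)\<bar> \<le> 34 * \<eta> * \<delta>"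
          using r_le[OF x] r_le[OF y] r_nonneg[OF x] r_nonneg[OF y] by (simp add: abs_le_iff)
        also have "\<dots> \<le> \<epsilon> * dist x y" using \<kappa> False \<delta> \<eta> \<open>\<epsilon> > 0\<close> by (intro mult_mono) auto
        finally show ?thesis .
      qed
    qed
    show ?thesis using gc gd G0 GM gM wf' fb' by (intro exI[of _ G] exI[of _ g]) (simp add: nonneg_C1_bounded_def)
  qed
  show ?thesis using \<open>C > 0\<close> main by (intro exI[of _ C] conjI allI impI)
qed

text \<open>The n-th residual is bounded by M / 2^n, so the next approximant and its gradient are
  bounded by C M / 2^n. The series of gradients converges uniformly, and the residuals tend to 0 on
  E.\<close>

theorem nonneg_whitney_extension:
  fixes E :: "'a::euclidean_space set"
  assumes E: "compact E" and wf: "whitney_field E f b"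
  shows "\<exists>F g. continuous_on UNIV g \<and> (\<forall>x. (F has_derivative (\<lambda>h. g x \<bullet> h)) (at x)) \<and>
           (\<forall>x. 0 \<le> F x) \<and> bounded (range F) \<and> bounded (range g) \<and> (\<forall>x\<in>E. F x = f x)"
proof -
  obtain M where "M > 0" and M: "field_bound E f b M" using whitney_field_bounded[OF E wf] by blast
  have "\<exists>C>0. \<forall>f b N \<epsilon>. whitney_field E f b \<longrightarrow> field_bound E f b N \<longrightarrow> N > 0 \<longrightarrow> \<epsilon> > 0 \<longrightarrow>
      (\<exists>G g. nonneg_C1_bounded (C * N) G g \<and> whitney_field E (\<lambda>x. f x - G x) (\<lambda>x. b x - g x) \<and>
        field_bound E (\<lambda>x. f x - G x) (\<lambda>x. b x - g x) \<epsilon>)"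
    by (rule ex_forward[OF nonneg_field_approximation], elim conjE, drule spec[of _ E]) (simp add: E)
  then obtain C where "C > 0" and C: "\<forall>f b N \<epsilon>. whitney_field E f b \<longrightarrow> field_bound E f b N \<longrightarrow> N > 0 \<longrightarrow> \<epsilon> > 0 \<longrightarrow>
      (\<exists>G g. nonneg_C1_bounded (C * N) G g \<and> whitney_field E (\<lambda>x. f x - G x) (\<lambda>x. b x - g x) \<and>
        field_bound E (\<lambda>x. f x - G x) (\<lambda>x. b x - g x) \<epsilon>)"
    by iprover
  define m where "m = (\<lambda>n. M * (1/2) ^ n)"
  have m: "m n > 0" for n using \<open>M > 0\<close> by (simp add: m_def)
  define P where "P = (\<lambda>n (s :: ('a \<Rightarrow> real) \<times> ('a \<Rightarrow> 'a)). whitney_field E (fst s) (snd s) \<and> field_bound E (fst s) (snd s) (m n))"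
  define Q where "Q = (\<lambda>n (s :: ('a \<Rightarrow> real) \<times> ('a \<Rightarrow> 'a)) s'. \<exists>G g. nonneg_C1_bounded (C * m n) G g \<and> fst s' = (\<lambda>x. fst s x - G x) \<and> snd s' = (\<lambda>x. snd s x - g x))"
  have "\<exists>s. (\<forall>n. P n (s n)) \<and> s 0 = (f, b) \<and> (\<forall>n. Q n (s n) (s (Suc n)))"
  proof -
    \<comment> \<open>The state is the current residual field. Its initial value is fixed by putting
      it into the invariant at index 0, as dependent choice leaves the start free.\<close>
    have "\<exists>s. (\<forall>n. (if n = 0 then s n = (f, b) else True) \<and> P n (s n)) \<and> (\<forall>n. Q n (s n) (s (Suc n)))"
    proof -
      have 1: "\<exists>x. (if (0::nat) = 0 then x = (f, b) else True) \<and> P 0 x"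
        using wf M by (simp add: P_def m_def)
      have 2: "\<exists>y. ((if Suc n = 0 then y = (f, b) else True) \<and> P (Suc n) y) \<and> Q n x y"
        if x: "(if n = 0 then x = (f, b) else True) \<and> P n x" for x n
      proof -
        obtain G g where G: "nonneg_C1_bounded (C * m n) G g" "whitney_field E (\<lambda>y. fst x y - G y) (\<lambda>y. snd x y - g y)"
          "field_bound E (\<lambda>y. fst x y - G y) (\<lambda>y. snd x y - g y) (m (Suc n))"
          using C[rule_format, of "fst x" "snd x" "m n" "m (Suc n)"] x m by (auto simp: P_def)
        then show ?thesis
          by (intro exI[of _ "(\<lambda>y. fst x y - G y, \<lambda>y. snd x y - g y)"]) (auto simp: P_def Q_def)
      qed
      from dependent_nat_choice[where P = "\<lambda>n s. (if n = 0 then s = (f, b) else True) \<and> P n s" and Q = Q, OF 1 2]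
      obtain s where "\<forall>n. ((if n = 0 then s n = (f, b) else True) \<and> P n (s n)) \<and> Q n (s n) (s (Suc n))"
        by blast
      then show ?thesis by (intro exI[of _ s]) simp
    qed
    then show ?thesis by (metis (full_types))
  qed
  then obtain s where s: "\<And>n. P n (s n)" "s 0 = (f, b)" "\<And>n. Q n (s n) (s (Suc n))" by blast
  then obtain G g where Gg: "\<And>n. nonneg_C1_bounded (C * m n) (G n) (g n)"
    "\<And>n. fst (s (Suc n)) = (\<lambda>x. fst (s n) x - G n x)" unfolding Q_def by metis
  have gc: "continuous_on UNIV (g n)" and gd: "(G n has_derivative (\<lambda>h. g n x \<bullet> h)) (at x)"
    and G0: "0 \<le> G n x" and GM: "G n x \<le> C * m n" and gM: "norm (g n x) \<le> C * m n" for n x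
    using Gg(1)[of n] by (auto simp: nonneg_C1_bounded_def)
  have sm: "(\<lambda>n. C * m n) sums (C * (M * 2))"
    unfolding m_def using geometric_sums[of "1/2 :: real"] by (intro sums_mult) simp
  have ul: "uniform_limit UNIV (\<lambda>n x. \<Sum>i<n. g i x) (\<lambda>x. \<Sum>i. g i x) sequentially"
    by (rule Weierstrass_m_test[OF gM sums_summable[OF sm]])
  define g' where "g' = (\<lambda>x. \<Sum>i. g i x)"
  have g'c: "continuous_on UNIV g'"
    unfolding g'_def
    by (rule uniform_limit_theorem[OF _ ul]) (auto intro!: always_eventually continuous_on_sum gc)
  have summG: "summable (\<lambda>n. G n x)" for x
    by (rule summable_comparison_test'[OF sums_summable[OF sm]]) (use G0 GM in auto)
  have "\<exists>F. \<forall>x\<in>UNIV. (\<lambda>n. G n x) sums F x \<and> (F has_derivative (\<lambda>h. g' x \<bullet> h)) (at x within UNIV)"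
  proof (rule has_derivative_series[where f' = "\<lambda>n x h. g n x \<bullet> h" and x = 0])
    fix e :: real assume "e > 0"
    then have "\<forall>\<^sub>F n in sequentially. \<forall>x\<in>UNIV. dist (\<Sum>i<n. g i x) (g' x) < e"
      using ul unfolding uniform_limit_iff g'_def by blast
    then show "\<forall>\<^sub>F n in sequentially. \<forall>x\<in>UNIV. \<forall>h. norm ((\<Sum>i<n. g i x \<bullet> h) - g' x \<bullet> h) \<le> e * norm h"
    proof (rule eventually_mono, intro ballI allI)
      fix n x h assume "\<forall>x\<in>UNIV. dist (\<Sum>i<n. g i x) (g' x) < e"
      then have "norm ((\<Sum>i<n. g i x) - g' x) \<le> e" by (simp add: dist_norm less_imp_le)
      moreover have "norm (((\<Sum>i<n. g i x) - g' x) \<bullet> h) \<le> norm ((\<Sum>i<n. g i x) - g' x) * norm h"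
        unfolding real_norm_def by (rule Cauchy_Schwarz_ineq2)
      ultimately show "norm ((\<Sum>i<n. g i x \<bullet> h) - g' x \<bullet> h) \<le> e * norm h"
        unfolding inner_sum_left[symmetric] inner_diff_left[symmetric]
        by (meson mult_right_mono norm_ge_zero order_trans)
    qed
  qed (use gd summable_sums[OF summG] in auto)
  then obtain F where F: "\<And>x. (\<lambda>n. G n x) sums F x" "\<And>x. (F has_derivative (\<lambda>h. g' x \<bullet> h)) (at x)"
    by auto
  have F0: "0 \<le> F x" for x using sums_le[OF _ sums_zero F(1)] G0 by blast
  have FM: "F x \<le> C * (M * 2)" for x using sums_le[OF _ F(1) sm] GM by blast
  have "norm (g' x) \<le> C * (M * 2)" for x
  proof -
    have "summable (\<lambda>n. norm (g n x))"
      by (rule summable_comparison_test'[OF sums_summable[OF sm]]) (use gM in auto)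
    then have "norm (g' x) \<le> (\<Sum>n. norm (g n x))" unfolding g'_def by (rule summable_norm)
    also have "\<dots> \<le> C * (M * 2)"
      using sums_le[OF _ summable_sums[OF \<open>summable (\<lambda>n. norm (g n x))\<close>] sm] gM by blast
    finally show ?thesis .
  qed
  then have "bounded (range g')" by (auto simp: bounded_iff)
  moreover have "bounded (range F)" using F0 FM by (auto simp: bounded_iff intro!: exI[of _ "C * (M * 2)"])
  moreover have "F x = f x" if x: "x \<in> E" for x
  proof -
    have part: "(\<Sum>i<n. G i x) = f x - fst (s n) x" for n
      by (induction n) (simp_all add: s(2) Gg(2))
    have b: "0 \<le> fst (s n) x" "fst (s n) x \<le> m n" for n
      using s(1)[of n] x by (auto simp: P_def whitney_field_def field_bound_def)
    have "(\<lambda>n. M * (1/2) ^ n) \<longlonglongrightarrow> M * 0"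
      by (intro tendsto_mult_left LIMSEQ_realpow_zero) auto
    then have m0: "m \<longlonglongrightarrow> 0" by (simp add: m_def[abs_def])
    have "(\<lambda>n. fst (s n) x) \<longlonglongrightarrow> 0"
      by (rule Lim_null_comparison[OF _ m0]) (simp add: b)
    then have "(\<lambda>n. f x - fst (s n) x) \<longlonglongrightarrow> f x - 0" by (intro tendsto_diff tendsto_const)
    then have "(\<lambda>n. G n x) sums f x" by (simp add: sums_def part)
    then show ?thesis using F(1) sums_unique2 by blast
  qed
  ultimately show ?thesis using g'c F(2) F0 by (intro exI[of _ F] exI[of _ g']) simp
qed

section \<open>Lower semicontinuous parts of affine bundles\<close>

text \<open>Known in selection theory as the derived mapping. That it fixes \<Phi> at all points of
  E is lower semicontinuity of \<Phi> on E.\<close>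

definition lsc_part ::
    "'a::metric_space set \<Rightarrow> ('a \<Rightarrow> 'b::metric_space set) \<Rightarrow> 'a \<Rightarrow> 'b set" where
  "lsc_part E \<Phi> x =
     {b \<in> \<Phi> x. \<forall>\<epsilon>>0. \<exists>\<delta>>0. \<forall>y\<in>E \<inter> ball x \<delta>. \<exists>c\<in>\<Phi> y. dist b c < \<epsilon>}"

lemma lsc_part_subset: "lsc_part E \<Phi> x \<subseteq> \<Phi> x"
  by (auto simp: lsc_part_def)

lemma lsc_partD:
  assumes "b \<in> lsc_part E \<Phi> x" "\<epsilon> > 0"
  shows "\<exists>\<delta>>0. \<forall>y\<in>E \<inter> ball x \<delta>. \<exists>c\<in>\<Phi> y. dist b c < \<epsilon>"
  using assms by (simp add: lsc_part_def)

lemma lsc_partI: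
  assumes "b \<in> \<Phi> x"
    and "\<And>\<epsilon>. \<epsilon> > 0 \<Longrightarrow> \<exists>\<delta>>0. \<forall>y\<in>E \<inter> ball x \<delta>. \<exists>c\<in>\<Phi> y. dist b c < \<epsilon>"
  shows "b \<in> lsc_part E \<Phi> x"
  using assms by (simp add: lsc_part_def)

lemma lsc_part_funpow_antimono:
  assumes "m \<le> m'"
  shows "(lsc_part E ^^ m') \<Phi> x \<subseteq> (lsc_part E ^^ m) \<Phi> x"
  using assms by (induction rule: dec_induct) (use lsc_part_subset in force)+

lemma affine_lsc_part:
  fixes \<Phi> :: "'a::metric_space \<Rightarrow> 'b::real_normed_vector set"
  assumes "\<And>y. y \<in> E \<Longrightarrow> affine (\<Phi> y)" "x \<in> E"
  shows "affine (lsc_part E \<Phi> x)"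
  unfolding affine_def
proof (intro ballI allI impI)
  fix b1 b2 :: 'b and u v :: real
  assume b: "b1 \<in> lsc_part E \<Phi> x" "b2 \<in> lsc_part E \<Phi> x" and uv: "u + v = 1"
  have "\<exists>\<delta>>0. \<forall>y\<in>E \<inter> ball x \<delta>. \<exists>c\<in>\<Phi> y. dist (u *\<^sub>R b1 + v *\<^sub>R b2) c < \<epsilon>" if "\<epsilon> > 0" for \<epsilon>
  proof -
    define \<eta> where "\<eta> = \<epsilon> / (\<bar>u\<bar> + \<bar>v\<bar> + 1)"
    have uv1: "\<bar>u\<bar> + \<bar>v\<bar> + 1 > 0" by linarith
    then have \<eta>: "\<eta> > 0" using that unfolding \<eta>_def by (intro divide_pos_pos)
    obtain \<delta>1 where \<delta>1: "\<delta>1 > 0" "\<And>y. y \<in> E \<inter> ball x \<delta>1 \<Longrightarrow> \<exists>c\<in>\<Phi> y. dist b1 c < \<eta>"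
      using lsc_partD[OF b(1) \<eta>] by metis
    obtain \<delta>2 where \<delta>2: "\<delta>2 > 0" "\<And>y. y \<in> E \<inter> ball x \<delta>2 \<Longrightarrow> \<exists>c\<in>\<Phi> y. dist b2 c < \<eta>"
      using lsc_partD[OF b(2) \<eta>] by metis
    show ?thesis
    proof (intro exI[of _ "min \<delta>1 \<delta>2"] conjI ballI)
      fix y assume y: "y \<in> E \<inter> ball x (min \<delta>1 \<delta>2)"
      then obtain c1 c2 where c: "c1 \<in> \<Phi> y" "dist b1 c1 < \<eta>" "c2 \<in> \<Phi> y" "dist b2 c2 < \<eta>"
        using \<delta>1(2)[of y] \<delta>2(2)[of y] by auto
      have "dist (u *\<^sub>R b1 + v *\<^sub>R b2) (u *\<^sub>R c1 + v *\<^sub>R c2) = norm (u *\<^sub>R (b1 - c1) + v *\<^sub>R (b2 - c2))"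
        by (simp add: dist_norm algebra_simps)
      also have "\<dots> \<le> \<bar>u\<bar> * norm (b1 - c1) + \<bar>v\<bar> * norm (b2 - c2)"
        by (metis norm_scaleR norm_triangle_ineq)
      also have "\<dots> \<le> \<bar>u\<bar> * \<eta> + \<bar>v\<bar> * \<eta>"
        using c by (intro add_mono mult_left_mono) (auto simp: dist_norm)
      also have "\<dots> < (\<bar>u\<bar> + \<bar>v\<bar> + 1) * \<eta>" using \<eta> by (simp add: algebra_simps)
      also have "\<dots> = \<epsilon>" unfolding \<eta>_def using uv1 by (intro nonzero_mult_div_cancel_left[THEN trans[OF times_divide_eq_right]]) simp
      finally have "dist (u *\<^sub>R b1 + v *\<^sub>R b2) (u *\<^sub>R c1 + v *\<^sub>R c2) < \<epsilon>" .
      moreover have "u *\<^sub>R c1 + v *\<^sub>R c2 \<in> \<Phi> y"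
        using assms(1)[of y] y c uv unfolding affine_def by blast
      ultimately show "\<exists>c\<in>\<Phi> y. dist (u *\<^sub>R b1 + v *\<^sub>R b2) c < \<epsilon>" by blast
    qed (use \<delta>1 \<delta>2 in simp)
  qed
  moreover have "u *\<^sub>R b1 + v *\<^sub>R b2 \<in> \<Phi> x"
    using assms b uv unfolding affine_def lsc_part_def by blast
  ultimately show "u *\<^sub>R b1 + v *\<^sub>R b2 \<in> lsc_part E \<Phi> x"
    by (simp add: lsc_part_def)
qed

lemma affine_lsc_part_funpow:
  fixes \<Phi> :: "'a::metric_space \<Rightarrow> 'b::real_normed_vector set"
  assumes "\<And>y. y \<in> E \<Longrightarrow> affine (\<Phi> y)" "x \<in> E"
  shows "affine ((lsc_part E ^^ m) \<Phi> x)"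
  using assms(2) by (induction m arbitrary: x) (auto intro: affine_lsc_part assms(1))

text \<open>A finite net of K at distance \<epsilon> / 2 leaves finitely many radii to minimize. It
  serves to compare a unit ball of a fibre with the neighbouring fibres.\<close>

lemma lsc_part_uniform:
  assumes "compact K" "K \<subseteq> lsc_part E \<Phi> x" "\<epsilon> > 0"
  shows "\<exists>\<delta>>0. \<forall>y\<in>E \<inter> ball x \<delta>. \<forall>b\<in>K. \<exists>c\<in>\<Phi> y. dist b c < \<epsilon>"
proof -
  obtain T where T: "finite T" "T \<subseteq> K" "K \<subseteq> (\<Union>b\<in>T. ball b (\<epsilon> / 2))"
    using compactE_image[OF \<open>compact K\<close>, of K "\<lambda>b. ball b (\<epsilon> / 2)"] \<open>\<epsilon> > 0\<close> by force
  have "\<forall>b\<in>T. \<exists>\<delta>>0. \<forall>y\<in>E \<inter> ball x \<delta>. \<exists>c\<in>\<Phi> y. dist b c < \<epsilon> / 2"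
  proof
    fix b assume "b \<in> T"
    then have "b \<in> lsc_part E \<Phi> x" using T(2) assms by blast
    then show "\<exists>\<delta>>0. \<forall>y\<in>E \<inter> ball x \<delta>. \<exists>c\<in>\<Phi> y. dist b c < \<epsilon> / 2"
      using \<open>\<epsilon> > 0\<close> by (intro lsc_partD) auto
  qed
  then obtain \<delta> where \<delta>: "\<And>b. b \<in> T \<Longrightarrow> \<delta> b > 0"
    "\<And>b y. b \<in> T \<Longrightarrow> y \<in> E \<inter> ball x (\<delta> b) \<Longrightarrow> \<exists>c\<in>\<Phi> y. dist b c < \<epsilon> / 2"
    by metis
  define d where "d = Min (insert 1 (\<delta> ` T))"
  have d: "d > 0" "\<And>b. b \<in> T \<Longrightarrow> d \<le> \<delta> b"
    using T(1) \<delta>(1) by (auto simp: d_def)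
  have "\<exists>c\<in>\<Phi> y. dist b c < \<epsilon>" if y: "y \<in> E \<inter> ball x d" and b: "b \<in> K" for y b
  proof -
    obtain t where t: "t \<in> T" "dist t b < \<epsilon> / 2" using T(3) b by auto
    then obtain c where "c \<in> \<Phi> y" "dist t c < \<epsilon> / 2" using \<delta>(2)[of t y] d(2)[of t] y by auto
    with t show ?thesis by (metis dist_triangle_half_r)
  qed
  with d(1) show ?thesis by blast
qed

section \<open>Fibre dimension and stabilization\<close>

lemma exists_orthogonal_direction:
  fixes V W :: "'a::euclidean_space set"
  assumes "subspace V" "subspace W" "dim W < dim V"
  shows "\<exists>v\<in>V. norm v = 1 \<and> (\<forall>w\<in>W. w \<bullet> v = 0)"
proof -
  define W' where "W' = {y. \<forall>x\<in>W. orthogonal x y}"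
  have "subspace W'" unfolding W'_def by (rule subspace_orthogonal_to_vectors)
  have "dim W' + dim W = DIM('a)"
    using dim_subspace_orthogonal_to_vectors[OF \<open>subspace W\<close> subspace_UNIV] by (simp add: W'_def)
  moreover have "dim {x + y |x y. x \<in> V \<and> y \<in> W'} + dim (V \<inter> W') = dim V + dim W'"
    using dim_sums_Int[OF \<open>subspace V\<close> \<open>subspace W'\<close>] .
  moreover have "dim {x + y |x y. x \<in> V \<and> y \<in> W'} \<le> DIM('a)" by (rule dim_subset_UNIV)
  ultimately have "dim (V \<inter> W') > 0" using assms(3) by linarith
  then have "\<not> V \<inter> W' \<subseteq> {0}" by (metis dim_eq_0 less_irrefl)
  then obtain u where u: "u \<in> V" "u \<in> W'" "u \<noteq> 0" by blast
  have "u /\<^sub>R norm u \<in> V" using u \<open>subspace V\<close> by (simp add: subspace_scale)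
  moreover have "norm (u /\<^sub>R norm u) = 1" using u by simp
  moreover have "\<forall>w\<in>W. w \<bullet> (u /\<^sub>R norm u) = 0" using u by (simp add: W'_def orthogonal_def)
  ultimately show ?thesis by blast
qed

text \<open>A neighbouring fibre of smaller dimension would miss some unit direction v of the fibre
  at x, being orthogonal to it. But p and p + v are both within 1/2 of that fibre, so one of its
  directions is at distance below 1 from v, which orthogonality forbids.\<close>

lemma aff_dim_lsc_part_le:
  fixes \<Phi> :: "'a::metric_space \<Rightarrow> 'b::euclidean_space set"
  assumes aff: "\<And>y. y \<in> E \<Longrightarrow> affine (\<Phi> y)" and x: "x \<in> E"
  shows "\<exists>\<delta>>0. \<forall>y\<in>E \<inter> ball x \<delta>. aff_dim (lsc_part E \<Phi> x) \<le> aff_dim (\<Phi> y)"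
proof (cases "lsc_part E \<Phi> x = {}")
  case True
  then show ?thesis by (intro exI[of _ 1]) (simp add: aff_dim_geq)
next
  case False
  then obtain p where p: "p \<in> lsc_part E \<Phi> x" by blast
  define S where "S = lsc_part E \<Phi> x"
  have S: "affine S" unfolding S_def using aff x by (rule affine_lsc_part)
  define V where "V = (\<lambda>s. s - p) ` S"
  have V: "subspace V"
    using affine_diffs_subspace_subtract[OF S, of p] p by (simp add: V_def S_def)
  have dV: "aff_dim S = int (dim V)"
    using aff_dim_eq_dim_subtract[of p S] p by (simp add: V_def S_def hull_inc)
  have "compact (S \<inter> cball p 1)"
    using affine_closed[OF S] by (simp add: closed_Int_compact)
  then obtain \<delta> where \<delta>: "\<delta> > 0"
    "\<And>y b. y \<in> E \<inter> ball x \<delta> \<Longrightarrow> b \<in> S \<inter> cball p 1 \<Longrightarrow> \<exists>c\<in>\<Phi> y. dist b c < 1 / 2"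
    using lsc_part_uniform[of "S \<inter> cball p 1" E \<Phi> x "1/2"] unfolding S_def by auto
  have "aff_dim S \<le> aff_dim (\<Phi> y)" if y: "y \<in> E \<inter> ball x \<delta>" for y
  proof (rule ccontr)
    assume less: "\<not> aff_dim S \<le> aff_dim (\<Phi> y)"
    obtain q where q: "q \<in> \<Phi> y" "dist p q < 1 / 2"
      using \<delta>(2)[OF y, of p] p by (auto simp: S_def)
    define W where "W = (\<lambda>s. s - q) ` \<Phi> y"
    have "affine (\<Phi> y)" using aff y by blast
    then have "subspace W" "aff_dim (\<Phi> y) = int (dim W)"
      using affine_diffs_subspace_subtract[of "\<Phi> y" q] aff_dim_eq_dim_subtract[of q "\<Phi> y"] q
      by (simp_all add: W_def hull_inc)
    then obtain v where v: "v \<in> V" "norm v = 1" "\<And>w. w \<in> W \<Longrightarrow> w \<bullet> v = 0"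
      using exists_orthogonal_direction[OF V \<open>subspace W\<close>] less dV by auto
    have "p + v \<in> S \<inter> cball p 1" using v by (auto simp: V_def dist_norm)
    then obtain q' where q': "q' \<in> \<Phi> y" "dist (p + v) q' < 1 / 2" using \<delta>(2)[OF y] by blast
    then have "(q' - q) \<bullet> v = 0" using v(3) by (auto simp: W_def)
    moreover have "norm (v - (q' - q)) < 1"
    proof -
      have "v - (q' - q) = (p + v - q') - (p - q)" by simp
      then have "norm (v - (q' - q)) \<le> norm (p + v - q') + norm (p - q)"
        by (metis norm_triangle_ineq4)
      then show ?thesis using q(2) q'(2) unfolding dist_norm by linarith
    qed
    moreover have "(v - (q' - q)) \<bullet> v \<le> norm (v - (q' - q)) * norm v" by (rule norm_cauchy_schwarz)
    ultimately show False
      using v(2) by (simp add: inner_diff_left dot_square_norm)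
  qed
  with \<delta>(1) show ?thesis unfolding S_def by blast
qed

lemma lsc_part_cong_local:
  assumes "\<delta> > 0" "\<And>y. y \<in> E \<inter> ball x \<delta> \<Longrightarrow> \<Phi> y = \<Psi> y" "y \<in> E \<inter> ball x \<delta>"
  shows "lsc_part E \<Phi> y \<subseteq> lsc_part E \<Psi> y"
proof
  fix b assume b: "b \<in> lsc_part E \<Phi> y"
  have "\<exists>\<delta>'>0. \<forall>z\<in>E \<inter> ball y \<delta>'. \<exists>c\<in>\<Psi> z. dist b c < \<epsilon>" if \<epsilon>: "\<epsilon> > 0" for \<epsilon>
  proof -
    obtain d where d: "d > 0" "\<And>z. z \<in> E \<inter> ball y d \<Longrightarrow> \<exists>c\<in>\<Phi> z. dist b c < \<epsilon>"
      using lsc_partD[OF b \<epsilon>] by metis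
    show ?thesis
    proof (intro exI[of _ "min d (\<delta> - dist x y)"] conjI ballI)
      show "0 < min d (\<delta> - dist x y)" using d assms by simp
      fix z assume z: "z \<in> E \<inter> ball y (min d (\<delta> - dist x y))"
      then have "z \<in> E \<inter> ball x \<delta>" using dist_triangle[of x z y] by auto
      then show "\<exists>c\<in>\<Psi> z. dist b c < \<epsilon>" using d(2)[of z] assms(2)[of z] z by auto
    qed
  qed
  moreover have "b \<in> \<Psi> y" using b assms by (auto simp: lsc_part_def)
  ultimately show "b \<in> lsc_part E \<Psi> y" by (intro lsc_partI)
qed

text \<open>Stationarity must hold on a whole ball to persist, since the next step at a point looks
  at the fibres around it.\<close>

lemma lsc_part_funpow_stable_local:
  assumes "\<delta> > 0" "\<And>y. y \<in> E \<inter> ball x \<delta> \<Longrightarrow> lsc_part E \<Phi> y = \<Phi> y" "y \<in> E \<inter> ball x \<delta>"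
  shows "(lsc_part E ^^ m) \<Phi> y = \<Phi> y"
  using assms(3)
proof (induction m arbitrary: y)
  case (Suc m)
  have "lsc_part E ((lsc_part E ^^ m) \<Phi>) y = lsc_part E \<Phi> y"
    using Suc by (intro equalityI lsc_part_cong_local[OF \<open>\<delta> > 0\<close>]) auto
  with assms(2)[OF Suc.prems] show ?case by simp
qed simp

text \<open>
  Fefferman's stabilization argument: the fibre dimension drops by at least one in every two
  steps at each point at which the iteration has not yet become stationary nearby.
\<close>

lemma lsc_part_stabilizes:
  fixes \<Phi> :: "'a::metric_space \<Rightarrow> 'b::euclidean_space set"
  assumes aff: "\<And>y. y \<in> E \<Longrightarrow> affine (\<Phi> y)"
    and "x \<in> E" "int DIM('b) \<le> aff_dim ((lsc_part E ^^ (2 * k + 1)) \<Phi> x) + int k" "m \<ge> 2 * k + 1"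
  shows "(lsc_part E ^^ m) \<Phi> x = (lsc_part E ^^ (2 * k + 1)) \<Phi> x"
  using assms(2-4)
proof (induction k arbitrary: x m)
  \<comment> \<open>A full-dimensional fibre after one step forces the original fibres nearby to be
    the whole space.\<close>
  case 0
  obtain \<delta> where \<delta>: "\<delta> > 0" "\<And>y. y \<in> E \<inter> ball x \<delta> \<Longrightarrow> aff_dim (lsc_part E \<Phi> x) \<le> aff_dim (\<Phi> y)"
    using aff_dim_lsc_part_le[of E \<Phi> x, OF aff \<open>x \<in> E\<close>] by blast
  have univ: "\<Phi> y = UNIV" if "y \<in> E \<inter> ball x \<delta>" for y
  proof -
    have "aff_dim (\<Phi> y) = int DIM('b)"
      using \<delta>(2)[OF that] 0 aff_dim_le_DIM[of "\<Phi> y"] by simp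
    then show ?thesis using aff[of y] that by (metis IntD1 aff_dim_eq_full affine_hull_eq)
  qed
  have "lsc_part E \<Phi> y = \<Phi> y" if y: "y \<in> E \<inter> ball x \<delta>" for y
  proof -
    have "lsc_part E (\<lambda>_. UNIV) y \<subseteq> lsc_part E \<Phi> y"
      using univ y by (intro lsc_part_cong_local[OF \<delta>(1)]) auto
    moreover have "lsc_part E (\<lambda>_. UNIV) y = (UNIV :: 'b set)"
      by (auto simp: lsc_part_def) (metis dist_self zero_less_one)
    ultimately show ?thesis using univ y by blast
  qed
  from lsc_part_funpow_stable_local[OF \<delta>(1) this, of x] show ?case
    using \<open>x \<in> E\<close> \<delta>(1) by (metis Int_iff centre_in_ball)
next
  case (Suc k)
  let ?\<Phi> = "\<lambda>m. (lsc_part E ^^ m) \<Phi>"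
  have affm: "affine (?\<Phi> m y)" if "y \<in> E" for m y
    using affine_lsc_part_funpow[OF aff that] .
  show ?case
  proof (cases "int DIM('b) \<le> aff_dim (?\<Phi> (2 * k + 1) x) + int k")
    case True
    then show ?thesis
      using Suc.IH[OF Suc.prems(1) True, of m] Suc.IH[OF Suc.prems(1) True, of "2 * Suc k + 1"] Suc.prems(3)
      by simp
  next
    case False
    \<comment> \<open>If the level 2k + 1 fibre at y has codimension at most k, the induction
      hypothesis applies at y. Otherwise both fibres have codimension k + 1, and nested affine sets
      of equal dimension coincide.\<close>
    have step: "?\<Phi> (2 * k + 1) y = ?\<Phi> (2 * k + 2) y"
      if y: "y \<in> E" and d: "int DIM('b) \<le> aff_dim (?\<Phi> (2 * k + 2) y) + int (Suc k)" for y
    proof (cases "int DIM('b) \<le> aff_dim (?\<Phi> (2 * k + 1) y) + int k")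
      case True
      from Suc.IH[OF y True, of "2 * k + 2"] show ?thesis by simp
    next
      case False
      have sub: "?\<Phi> (2 * k + 2) y \<subseteq> ?\<Phi> (2 * k + 1) y"
        by (rule lsc_part_funpow_antimono) simp
      show ?thesis
      proof (cases "?\<Phi> (2 * k + 2) y = {}")
        case True
        \<comment> \<open>The empty fibre has dimension -1. A nonempty fibre one level earlier would
          then have codimension at most k, contrary to the case assumption.\<close>
        have "int DIM('b) \<le> int k" using d True by simp
        then have "int DIM('b) \<le> aff_dim (?\<Phi> (2 * k + 1) y) + int k \<or> ?\<Phi> (2 * k + 1) y = {}"
          using aff_dim_negative_iff[of "?\<Phi> (2 * k + 1) y"] by linarith
        then show ?thesis using False True by blast
      next
        case nonempty: False
        have "aff_dim (?\<Phi> (2 * k + 2) y) \<le> aff_dim (?\<Phi> (2 * k + 1) y)"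
          by (rule aff_dim_subset[OF sub])
        with False d have "aff_dim (?\<Phi> (2 * k + 2) y) = aff_dim (?\<Phi> (2 * k + 1) y)" by simp
        then show ?thesis
          using affine_dim_equal[OF affm[OF y] affm[OF y] nonempty sub] by simp
      qed
    qed
    have e: "2 * Suc k + 1 = Suc (2 * k + 2)" "2 * k + 2 = Suc (2 * k + 1)" by simp_all
    \<comment> \<open>Why two levels per dimension: \<open>step\<close> compares levels 2k + 1 and
      2k + 2 at one point, and the passage to level 2k + 3 at x carries its dimension hypothesis to
      all points near x.\<close>
    obtain \<delta> where \<delta>: "\<delta> > 0"
      "\<And>y. y \<in> E \<inter> ball x \<delta> \<Longrightarrow> aff_dim (lsc_part E (?\<Phi> (2 * k + 2)) x) \<le> aff_dim (?\<Phi> (2 * k + 2) y)"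
      using aff_dim_lsc_part_le[of E "?\<Phi> (2 * k + 2)" x, OF affm Suc.prems(1)] by blast
    have "lsc_part E (?\<Phi> (2 * k + 1)) y = ?\<Phi> (2 * k + 1) y" if "y \<in> E \<inter> ball x \<delta>" for y
    proof -
      have "int DIM('b) \<le> aff_dim (?\<Phi> (2 * k + 2) y) + int (Suc k)"
        using \<delta>(2)[OF that] Suc.prems(2) unfolding e(1) by simp
      then show ?thesis using step[of y] that unfolding e(2) by simp
    qed
    from lsc_part_funpow_stable_local[OF \<delta>(1) this, of x]
    have st: "(lsc_part E ^^ j) (?\<Phi> (2 * k + 1)) x = ?\<Phi> (2 * k + 1) x" for j
      using Suc.prems(1) \<delta>(1) by (metis Int_iff centre_in_ball)
    have "?\<Phi> j x = ?\<Phi> (2 * k + 1) x" if "j \<ge> 2 * k + 1" for j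
      using st[of "j - (2 * k + 1)"] that by (metis comp_apply funpow_add le_add_diff_inverse2)
    from this[of m] this[of "2 * Suc k + 1"] show ?thesis using Suc.prems(3) by simp
  qed
qed

subsection \<open>Michael's selection theorem\<close>

lemma lsc_approximate_selection:
  fixes \<Phi> :: "'a::metric_space \<Rightarrow> 'b::real_normed_vector set"
  assumes E: "compact E" and ne: "\<And>x. x \<in> E \<Longrightarrow> \<Phi> x \<noteq> {}"
    and conv: "\<And>x. x \<in> E \<Longrightarrow> convex (\<Phi> x)"
    and lsc: "\<And>x. x \<in> E \<Longrightarrow> lsc_part E \<Phi> x = \<Phi> x" and "\<epsilon> > 0"
  shows "\<exists>g. continuous_on E g \<and> (\<forall>x\<in>E. \<exists>c\<in>\<Phi> x. dist (g x) c < \<epsilon>)"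
proof -
  have "\<forall>x\<in>E. \<exists>b \<delta>. b \<in> \<Phi> x \<and> \<delta> > 0 \<and> (\<forall>y\<in>E \<inter> ball x \<delta>. \<exists>c\<in>\<Phi> y. dist b c < \<epsilon>)"
  proof
    fix x assume x: "x \<in> E"
    then obtain b where "b \<in> \<Phi> x" using ne by blast
    then have "b \<in> lsc_part E \<Phi> x" using lsc x by simp
    then show "\<exists>b \<delta>. b \<in> \<Phi> x \<and> \<delta> > 0 \<and> (\<forall>y\<in>E \<inter> ball x \<delta>. \<exists>c\<in>\<Phi> y. dist b c < \<epsilon>)"
      using \<open>\<epsilon> > 0\<close> by (auto simp: lsc_part_def)
  qed
  then obtain b \<delta> where b: "\<And>x. x \<in> E \<Longrightarrow> b x \<in> \<Phi> x" "\<And>x. x \<in> E \<Longrightarrow> \<delta> x > 0"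
    "\<And>x y. x \<in> E \<Longrightarrow> y \<in> E \<inter> ball x (\<delta> x) \<Longrightarrow> \<exists>c\<in>\<Phi> y. dist (b x) c < \<epsilon>"
    by metis
  obtain T where T: "finite T" "T \<subseteq> E" "E \<subseteq> (\<Union>t\<in>T. ball t (\<delta> t))"
    using compactE_image[OF E, of E "\<lambda>t. ball t (\<delta> t)"] b(2) by force
  define w where "w = (\<lambda>t x. max 0 (\<delta> t - dist t x))"
  define W where "W = (\<lambda>x. \<Sum>t\<in>T. w t x)"
  have w: "0 \<le> w t x" for t x by (simp add: w_def)
  have W: "W x > 0" if xE: "x \<in> E" for x
  proof -
    obtain t where "t \<in> T" "x \<in> ball t (\<delta> t)" using T(3) xE by blast
    then show ?thesis unfolding W_def using T(1) w by (intro sum_pos2[of T t]) (auto simp: w_def)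
  qed
  define g where "g = (\<lambda>x. \<Sum>t\<in>T. (w t x / W x) *\<^sub>R b t)"
  have "continuous_on E g"
    unfolding g_def w_def W_def using W
    by (intro continuous_intros) (auto simp: W_def w_def less_imp_neq[symmetric])
  moreover have "\<exists>c\<in>\<Phi> x. dist (g x) c < \<epsilon>" if x: "x \<in> E" for x
  proof -
    \<comment> \<open>Where the weight vanishes any point of the fibre is taken, so that the convex
      combination can run over all of \<open>T\<close>.\<close>
    have "\<forall>t\<in>T. \<exists>c. c \<in> \<Phi> x \<and> (w t x \<noteq> 0 \<longrightarrow> dist (b t) c < \<epsilon>)"
    proof
      fix t assume t: "t \<in> T"
      show "\<exists>c. c \<in> \<Phi> x \<and> (w t x \<noteq> 0 \<longrightarrow> dist (b t) c < \<epsilon>)"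
      proof (cases "w t x = 0")
        case True
        then show ?thesis using ne[OF x] by auto
      next
        case False
        then have "x \<in> E \<inter> ball t (\<delta> t)" using x by (auto simp: w_def max_def split: if_splits)
        from b(3)[OF _ this] show ?thesis using t T(2) by blast
      qed
    qed
    then obtain c where c: "\<And>t. t \<in> T \<Longrightarrow> c t \<in> \<Phi> x" "\<And>t. t \<in> T \<Longrightarrow> w t x \<noteq> 0 \<Longrightarrow> dist (b t) (c t) < \<epsilon>"
      by metis
    have one: "(\<Sum>t\<in>T. w t x / W x) = 1"
      using W[OF x] by (simp add: sum_divide_distrib[symmetric] W_def)
    have in\<Phi>: "(\<Sum>t\<in>T. (w t x / W x) *\<^sub>R c t) \<in> \<Phi> x"
      using T(1) conv[OF x] one c(1) w W[OF x] by (intro convex_sum) auto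
    obtain t0 where t0: "t0 \<in> T" "w t0 x \<noteq> 0"
      using W[OF x] unfolding W_def by (metis less_irrefl sum.neutral)
    have "dist (g x) (\<Sum>t\<in>T. (w t x / W x) *\<^sub>R c t) = norm (\<Sum>t\<in>T. (w t x / W x) *\<^sub>R (b t - c t))"
      by (simp add: g_def dist_norm sum_subtractf[symmetric] scaleR_diff_right)
    also have "\<dots> \<le> (\<Sum>t\<in>T. (w t x / W x) * norm (b t - c t))"
      by (rule sum_norm_le) (use w W[OF x] in auto)
    also have "\<dots> < (\<Sum>t\<in>T. (w t x / W x) * \<epsilon>)"
    proof (rule sum_strict_mono_ex1)
      show "\<forall>t\<in>T. w t x / W x * norm (b t - c t) \<le> w t x / W x * \<epsilon>"
      proof
        fix t assume "t \<in> T"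
        then show "w t x / W x * norm (b t - c t) \<le> w t x / W x * \<epsilon>"
          using c(2)[of t] mult_left_mono[of "norm (b t - c t)" \<epsilon> "w t x / W x"] w[of t x] W[OF x]
          by (cases "w t x = 0") (auto simp: dist_norm)
      qed
      have "0 < w t0 x / W x" using t0 w[of t0 x] W[OF x] by simp
      then show "\<exists>t\<in>T. w t x / W x * norm (b t - c t) < w t x / W x * \<epsilon>"
        using c(2)[OF t0] t0 by (intro bexI[of _ t0] mult_strict_left_mono) (auto simp: dist_norm)
    qed (use T in simp)
    also have "\<dots> = \<epsilon>" unfolding sum_distrib_right[symmetric] using one by simp
    finally show ?thesis using in\<Phi> by blast
  qed
  ultimately show ?thesis by blast
qed

text \<open>Approximate selections are improved by intersecting the fibres with balls around the
  previous one. Successive distances are then geometrically small, and closed fibres contain the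
  limit.\<close>

lemma lsc_continuous_selection:
  fixes \<Phi> :: "'a::metric_space \<Rightarrow> 'b::banach set"
  assumes E: "compact E" and ne: "\<And>x. x \<in> E \<Longrightarrow> \<Phi> x \<noteq> {}"
    and conv: "\<And>x. x \<in> E \<Longrightarrow> convex (\<Phi> x)" and cl: "\<And>x. x \<in> E \<Longrightarrow> closed (\<Phi> x)"
    and lsc: "\<And>x. x \<in> E \<Longrightarrow> lsc_part E \<Phi> x = \<Phi> x"
  shows "\<exists>g. continuous_on E g \<and> (\<forall>x\<in>E. g x \<in> \<Phi> x)"
proof -
  define P where "P = (\<lambda>n g. continuous_on E g \<and> (\<forall>x\<in>E. \<exists>c\<in>\<Phi> x. dist (g x) c < (1/2) ^ n))"
  have "\<exists>g. P 0 g"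
    using lsc_approximate_selection[OF E ne conv lsc, of 1] by (simp add: P_def)
  moreover have "\<exists>g'. P (Suc n) g' \<and> (\<forall>x\<in>E. dist (g x) (g' x) \<le> 2 * (1/2) ^ n)" if g: "P n g" for n g
  proof -
    define r :: real where "r = (1/2) ^ n"
    have r: "r > 0" by (simp add: r_def)
    \<comment> \<open>The ball is open, so a point of it has room to move: this preserves lower
      semicontinuity.\<close>
    define \<Psi> where "\<Psi> = (\<lambda>x. \<Phi> x \<inter> ball (g x) r)"
    have gc: "continuous_on E g" and g': "\<And>x. x \<in> E \<Longrightarrow> \<exists>c\<in>\<Phi> x. dist (g x) c < r"
      using g by (auto simp: P_def r_def)
    have "\<exists>g'. continuous_on E g' \<and> (\<forall>x\<in>E. \<exists>c\<in>\<Psi> x. dist (g' x) c < (1/2) ^ Suc n)"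
    proof (rule lsc_approximate_selection[OF E])
      show "\<Psi> x \<noteq> {}" if "x \<in> E" for x using g'[OF that] by (auto simp: \<Psi>_def)
      show "convex (\<Psi> x)" if "x \<in> E" for x
        unfolding \<Psi>_def using conv[OF that] by (intro convex_Int convex_ball)
      show "lsc_part E \<Psi> x = \<Psi> x" if x: "x \<in> E" for x
      proof (intro equalityI lsc_part_subset subsetI)
        fix b assume b: "b \<in> \<Psi> x"
        then have "b \<in> lsc_part E \<Phi> x" and bg: "dist (g x) b < r" using lsc[OF x] by (auto simp: \<Psi>_def)
        have "\<exists>\<delta>>0. \<forall>y\<in>E \<inter> ball x \<delta>. \<exists>c\<in>\<Psi> y. dist b c < \<epsilon>" if \<epsilon>: "\<epsilon> > 0" for \<epsilon>
        proof -
          \<comment> \<open>At most half of the room left between b and the boundary of the ball: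
            one share for passing from b to c, one for passing from \<open>g x\<close> to
            \<open>g y\<close>.\<close>
          define \<eta> where "\<eta> = min \<epsilon> ((r - dist (g x) b) / 2)"
          have \<eta>: "\<eta> > 0" "\<eta> \<le> \<epsilon>" "2 * \<eta> \<le> r - dist (g x) b" using \<epsilon> bg by (auto simp: \<eta>_def min_def field_simps)
          obtain \<delta>1 where \<delta>1: "\<delta>1 > 0" "\<And>y. y \<in> E \<inter> ball x \<delta>1 \<Longrightarrow> \<exists>c\<in>\<Phi> y. dist b c < \<eta>"
            using lsc_partD[OF \<open>b \<in> lsc_part E \<Phi> x\<close> \<eta>(1)] by metis
          obtain \<delta>2 where \<delta>2: "\<delta>2 > 0" "\<And>y. y \<in> E \<Longrightarrow> dist y x < \<delta>2 \<Longrightarrow> dist (g y) (g x) < \<eta>"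
            using gc \<eta>(1) x unfolding continuous_on_iff by metis
          show ?thesis
          proof (intro exI[of _ "min \<delta>1 \<delta>2"] conjI ballI)
            fix y assume y: "y \<in> E \<inter> ball x (min \<delta>1 \<delta>2)"
            then obtain c where c: "c \<in> \<Phi> y" "dist b c < \<eta>" using \<delta>1(2)[of y] by auto
            have "dist (g y) (g x) < \<eta>" using \<delta>2(2)[of y] y by (auto simp: dist_commute)
            then have "dist (g y) c < r"
              using c \<eta> dist_triangle[of "g y" c b] dist_triangle[of "g y" b "g x"] by linarith
            then show "\<exists>c\<in>\<Psi> y. dist b c < \<epsilon>" using c \<eta> by (intro bexI[of _ c]) (auto simp: \<Psi>_def)
          qed (use \<delta>1 \<delta>2 in simp)
        qed
        with b show "b \<in> lsc_part E \<Psi> x" by (rule lsc_partI)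
      qed
    qed simp
    then obtain g2 where g2: "continuous_on E g2" "\<And>x. x \<in> E \<Longrightarrow> \<exists>c\<in>\<Psi> x. dist (g2 x) c < (1/2) ^ Suc n"
      by blast
    have "dist (g x) (g2 x) \<le> 2 * (1/2) ^ n" if x: "x \<in> E" for x
    proof -
      obtain c where c: "dist (g x) c < r" "dist (g2 x) c < (1/2) ^ Suc n"
        using g2(2)[OF x] by (auto simp: \<Psi>_def)
      then show ?thesis using dist_triangle2[of "g x" "g2 x" c] r unfolding r_def power_Suc by linarith
    qed
    with g2 show ?thesis by (intro exI[of _ g2]) (auto simp: P_def \<Psi>_def)
  qed
  ultimately obtain g where g: "\<And>n. P n (g n)" "\<And>n x. x \<in> E \<Longrightarrow> dist (g n x) (g (Suc n) x) \<le> 2 * (1/2) ^ n"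
    using dependent_nat_choice[of P "\<lambda>n g g'. \<forall>x\<in>E. dist (g x) (g' x) \<le> 2 * (1/2) ^ n"] by metis
  define d where "d = (\<lambda>n x. g (Suc n) x - g n x)"
  have "uniform_limit E (\<lambda>n x. \<Sum>i<n. d i x) (\<lambda>x. \<Sum>i. d i x) sequentially"
  proof (rule Weierstrass_m_test)
    show "norm (d n x) \<le> 2 * (1/2) ^ n" if "x \<in> E" for n x
      using g(2)[OF that, of n] by (simp add: d_def dist_norm norm_minus_commute)
    show "summable (\<lambda>n. 2 * (1/2) ^ n :: real)"
      by (intro summable_mult summable_geometric) simp
  qed
  moreover have "(\<Sum>i<n. d i x) = g n x - g 0 x" for n x
    unfolding d_def by (rule sum_lessThan_telescope)
  ultimately have "uniform_limit E (\<lambda>n x. g n x - g 0 x + g 0 x) (\<lambda>x. (\<Sum>i. d i x) + g 0 x) sequentially"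
    by (intro uniform_limit_add uniform_limit_const) simp
  then have lim: "uniform_limit E g (\<lambda>x. (\<Sum>i. d i x) + g 0 x) sequentially" (is "uniform_limit E g ?h _")
    by simp
  have "continuous_on E ?h"
    using uniform_limit_theorem[OF _ lim] g(1) by (auto simp: P_def)
  moreover have "?h x \<in> \<Phi> x" if x: "x \<in> E" for x
  proof -
    have "\<forall>n. \<exists>c. c \<in> \<Phi> x \<and> dist (g n x) c < (1/2) ^ n"
      using g(1) x unfolding P_def by blast
    then obtain c where c: "\<And>n. c n \<in> \<Phi> x" "\<And>n. dist (g n x) (c n) < (1/2) ^ n"
      by metis
    have "(\<lambda>n. norm (g n x - c n)) \<longlonglongrightarrow> 0"
      unfolding dist_norm[symmetric]
      by (rule Lim_null_comparison[where g = "\<lambda>n. (1/2) ^ n"])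
         (use c(2) in \<open>auto intro!: always_eventually less_imp_le LIMSEQ_realpow_zero\<close>)
    moreover have "(\<lambda>n. g n x) \<longlonglongrightarrow> ?h x" using tendsto_uniform_limitI[OF lim x] .
    ultimately have "(\<lambda>n. g n x - (g n x - c n)) \<longlonglongrightarrow> ?h x - 0"
      by (intro tendsto_diff) (auto simp: tendsto_norm_zero_iff)
    then have "c \<longlonglongrightarrow> ?h x" by simp
    then show ?thesis using closed_sequentially[OF cl[OF x], of c] c(1) by blast
  qed
  ultimately show ?thesis by blast
qed

section \<open>Glaeser refinement\<close>

text \<open>Strict derivatives along E: both u and v vary. The condition is affine in b, which opens
  the way to the dimension count; at an isolated point of E it only contains the clause on
  zeros.\<close>

definition strict_gradients :: "'a::euclidean_space set \<Rightarrow> ('a \<Rightarrow> real) \<Rightarrow> 'a \<Rightarrow> 'a set" where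
  "strict_gradients E f x = {b. (f x = 0 \<longrightarrow> b = 0) \<and>
     (\<forall>\<epsilon>>0. \<exists>\<delta>>0. \<forall>u\<in>E \<inter> ball x \<delta>. \<forall>v\<in>E \<inter> ball x \<delta>.
        \<bar>f u - f v - b \<bullet> (u - v)\<bar> \<le> \<epsilon> * dist u v)}"

lemma affine_strict_gradients: "affine (strict_gradients E f x)"
  unfolding affine_def
proof (intro ballI allI impI)
  fix b c :: 'a and s t :: real
  assume b: "b \<in> strict_gradients E f x" and c: "c \<in> strict_gradients E f x" and st: "s + t = 1"
  have "\<exists>\<delta>>0. \<forall>u\<in>E \<inter> ball x \<delta>. \<forall>v\<in>E \<inter> ball x \<delta>.
      \<bar>f u - f v - (s *\<^sub>R b + t *\<^sub>R c) \<bullet> (u - v)\<bar> \<le> \<epsilon> * dist u v" if "\<epsilon> > 0" for \<epsilon>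
  proof -
    define \<eta> where "\<eta> = \<epsilon> / (\<bar>s\<bar> + \<bar>t\<bar> + 1)"
    have st1: "\<bar>s\<bar> + \<bar>t\<bar> + 1 > 0" by linarith
    then have \<eta>: "\<eta> > 0" "(\<bar>s\<bar> + \<bar>t\<bar> + 1) * \<eta> = \<epsilon>"
      using that unfolding \<eta>_def by (intro divide_pos_pos) auto
    obtain \<delta>1 where \<delta>1: "\<delta>1 > 0" "\<And>u v. u \<in> E \<inter> ball x \<delta>1 \<Longrightarrow> v \<in> E \<inter> ball x \<delta>1 \<Longrightarrow>
        \<bar>f u - f v - b \<bullet> (u - v)\<bar> \<le> \<eta> * dist u v"
      using b \<eta>(1) unfolding strict_gradients_def mem_Collect_eq by metis
    obtain \<delta>2 where \<delta>2: "\<delta>2 > 0" "\<And>u v. u \<in> E \<inter> ball x \<delta>2 \<Longrightarrow> v \<in> E \<inter> ball x \<delta>2 \<Longrightarrow>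
        \<bar>f u - f v - c \<bullet> (u - v)\<bar> \<le> \<eta> * dist u v"
      using c \<eta>(1) unfolding strict_gradients_def mem_Collect_eq by metis
    show ?thesis
    proof (intro exI[of _ "min \<delta>1 \<delta>2"] conjI ballI)
      fix u v assume uv: "u \<in> E \<inter> ball x (min \<delta>1 \<delta>2)" "v \<in> E \<inter> ball x (min \<delta>1 \<delta>2)"
      let ?B = "f u - f v - b \<bullet> (u - v)" and ?C = "f u - f v - c \<bullet> (u - v)"
      have "f u - f v = s * (f u - f v) + t * (f u - f v)" using st by (metis distrib_right mult_1)
      then have "f u - f v - (s *\<^sub>R b + t *\<^sub>R c) \<bullet> (u - v) = s * ?B + t * ?C"
        by (simp add: inner_add_left algebra_simps)
      moreover have "\<bar>s * ?B + t * ?C\<bar> \<le> \<bar>s\<bar> * \<bar>?B\<bar> + \<bar>t\<bar> * \<bar>?C\<bar>"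
        by (metis abs_mult abs_triangle_ineq)
      moreover have "\<bar>s\<bar> * \<bar>?B\<bar> \<le> \<bar>s\<bar> * (\<eta> * dist u v)" "\<bar>t\<bar> * \<bar>?C\<bar> \<le> \<bar>t\<bar> * (\<eta> * dist u v)"
        using uv \<delta>1(2)[of u v] \<delta>2(2)[of u v] by (auto intro!: mult_left_mono)
      moreover have "\<epsilon> * dist u v = \<bar>s\<bar> * (\<eta> * dist u v) + \<bar>t\<bar> * (\<eta> * dist u v) + \<eta> * dist u v"
        unfolding \<eta>(2)[symmetric] by (simp add: algebra_simps)
      moreover have "0 \<le> \<eta> * dist u v" using \<eta>(1) by simp
      ultimately show "\<bar>f u - f v - (s *\<^sub>R b + t *\<^sub>R c) \<bullet> (u - v)\<bar> \<le> \<epsilon> * dist u v" by linarith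
    qed (use \<delta>1 \<delta>2 in simp)
  qed
  then show "s *\<^sub>R b + t *\<^sub>R c \<in> strict_gradients E f x"
    using b c by (auto simp: strict_gradients_def)
qed

text \<open>By strictness the single vector \<open>b z\<close> serves all pairs of points near z,
  and a Lebesgue number of the covering by such neighbourhoods makes the scale uniform. Continuity
  of b pays for replacing \<open>b z\<close> by \<open>b x\<close>.\<close>

lemma whitney_field_strict_gradients:
  fixes E :: "'a::euclidean_space set"
  assumes E: "compact E" and "\<And>x. x \<in> E \<Longrightarrow> 0 \<le> f x" and bc: "continuous_on E b"
    and b: "\<And>x. x \<in> E \<Longrightarrow> b x \<in> strict_gradients E f x"
  shows "whitney_field E f b"
  unfolding whitney_field_def
proof (intro conjI ballI allI impI)
  fix \<epsilon> :: real assume \<epsilon>: "\<epsilon> > 0"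
  have "\<exists>\<delta>>0. \<forall>u\<in>E \<inter> ball x \<delta>. \<forall>v\<in>E \<inter> ball x \<delta>.
      \<bar>f u - f v - b x \<bullet> (u - v)\<bar> \<le> \<epsilon> / 2 * dist u v \<and> norm (b v - b x) \<le> \<epsilon> / 2" if x: "x \<in> E" for x
  proof -
    have "\<epsilon> / 2 > 0" using \<epsilon> by simp
    obtain \<delta>1 where \<delta>1: "\<delta>1 > 0" "\<And>u v. u \<in> E \<inter> ball x \<delta>1 \<Longrightarrow> v \<in> E \<inter> ball x \<delta>1 \<Longrightarrow>
        \<bar>f u - f v - b x \<bullet> (u - v)\<bar> \<le> \<epsilon> / 2 * dist u v"
      using b[OF x] \<open>\<epsilon> / 2 > 0\<close> unfolding strict_gradients_def mem_Collect_eq by metis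
    obtain \<delta>2 where \<delta>2: "\<delta>2 > 0" "\<And>v. v \<in> E \<Longrightarrow> dist v x < \<delta>2 \<Longrightarrow> dist (b v) (b x) < \<epsilon> / 2"
      using bc x \<open>\<epsilon> / 2 > 0\<close> unfolding continuous_on_iff by metis
    show ?thesis
    proof (intro exI[of _ "min \<delta>1 \<delta>2"] conjI ballI)
      fix u v assume "u \<in> E \<inter> ball x (min \<delta>1 \<delta>2)" "v \<in> E \<inter> ball x (min \<delta>1 \<delta>2)"
      then show "\<bar>f u - f v - b x \<bullet> (u - v)\<bar> \<le> \<epsilon> / 2 * dist u v" "norm (b v - b x) \<le> \<epsilon> / 2"
        using \<delta>1(2)[of u v] \<delta>2(2)[of v] by (auto simp: dist_commute dist_norm[of "b v" "b x"])
    qed (use \<delta>1 \<delta>2 in simp)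
  qed
  then obtain r where r: "\<And>x. x \<in> E \<Longrightarrow> r x > 0"
    "\<And>x u v. x \<in> E \<Longrightarrow> u \<in> E \<inter> ball x (r x) \<Longrightarrow> v \<in> E \<inter> ball x (r x) \<Longrightarrow>
      \<bar>f u - f v - b x \<bullet> (u - v)\<bar> \<le> \<epsilon> / 2 * dist u v \<and> norm (b v - b x) \<le> \<epsilon> / 2"
    by metis
  obtain \<delta> where \<delta>: "\<delta> > 0" "\<And>y. y \<in> E \<Longrightarrow> \<exists>B\<in>(\<lambda>x. ball x (r x)) ` E. ball y \<delta> \<subseteq> B"
    by (rule Heine_Borel_lemma[OF E, of "(\<lambda>x. ball x (r x)) ` E"]) (use r(1) in auto)
  show "\<exists>\<delta>>0. \<forall>x\<in>E. \<forall>y\<in>E. dist x y < \<delta> \<longrightarrow>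
      \<bar>f y - f x - b x \<bullet> (y - x)\<bar> \<le> \<epsilon> * dist x y \<and> norm (b y - b x) \<le> \<epsilon>"
  proof (intro exI[of _ \<delta>] conjI \<delta>(1) ballI impI)
    fix x y assume xy: "x \<in> E" "y \<in> E" "dist x y < \<delta>"
    obtain z where z: "z \<in> E" "ball x \<delta> \<subseteq> ball z (r z)" using \<delta>(2)[OF xy(1)] by blast
    moreover have "x \<in> ball x \<delta>" "y \<in> ball x \<delta>" using xy \<delta>(1) by auto
    ultimately have in_ball: "x \<in> E \<inter> ball z (r z)" "y \<in> E \<inter> ball z (r z)" using xy by blast+
    have *: "\<bar>f y - f x - b z \<bullet> (y - x)\<bar> \<le> \<epsilon> / 2 * dist x y" "norm (b x - b z) \<le> \<epsilon> / 2" "norm (b y - b z) \<le> \<epsilon> / 2"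
      using r(2)[OF z(1) in_ball(2,1)] r(2)[OF z(1) in_ball] by (auto simp: dist_commute)
    have "\<bar>(b x - b z) \<bullet> (y - x)\<bar> \<le> \<epsilon> / 2 * dist x y"
      using Cauchy_Schwarz_ineq2[of "b x - b z" "y - x"] mult_right_mono[OF *(2), of "dist x y"]
      by (simp add: dist_norm norm_minus_commute)
    moreover have "\<epsilon> / 2 * dist x y = \<epsilon> * dist x y / 2" by simp
    ultimately show "\<bar>f y - f x - b x \<bullet> (y - x)\<bar> \<le> \<epsilon> * dist x y"
      using *(1) unfolding inner_diff_left by linarith
    show "norm (b y - b x) \<le> \<epsilon>" using norm_triangle_ineq4[of "b y - b z" "b x - b z"] * by simp
  qed
qed (use assms in \<open>auto simp: strict_gradients_def\<close>)

section \<open>From polynomials and refinements to gradients\<close>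

lemma gradient_eq:
  fixes F :: "real ^ 'n \<Rightarrow> real"
  assumes "(F has_derivative (\<lambda>h. g \<bullet> h)) (at x)"
  shows "partial_deriv i F x = g $ i" and "gradient F x = g"
proof -
  show *: "partial_deriv i F x = g $ i" for i
    using frechet_derivative_at[OF assms, symmetric] by (simp add: partial_deriv_def inner_axis)
  show "gradient F x = g" by (simp add: gradient_def * vec_eq_iff)
qed

text \<open>A zero of a nonnegative F is a minimum, so the gradient of F vanishes there.\<close>

lemma Gamma1_subset:
  assumes "P \<in> Gamma1 f x"
  shows "\<exists>b. (f x = 0 \<longrightarrow> b = 0) \<and> P = (\<lambda>y. f x + b \<bullet> (y - x))"
proof -
  obtain F where F: "F \<in> C1_nonneg" "F x = f x" "P = jet1 x F"
    using assms by (auto simp: Gamma1_def)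
  have "gradient F x = 0" if "f x = 0"
  proof -
    have d: "(F has_derivative frechet_derivative F (at x)) (at x)"
      using F(1) by (simp add: C1_nonneg_def C1_bounded_def frechet_derivative_works)
    have "frechet_derivative F (at x) = (\<lambda>h. 0)"
      using F that by (intro has_derivative_local_min[OF d]) (auto simp: C1_nonneg_def)
    then show ?thesis by (simp add: gradient_def partial_deriv_def vec_eq_iff)
  qed
  then show ?thesis using F by (intro exI[of _ "gradient F x"]) (auto simp: jet1_def)
qed

text \<open>The trace of a refinement on two auxiliary points u and v, with c the gradient chosen at
  v. The one chosen at u does not appear: the values are compared at u, where its polynomial equals
  f u.\<close>

definition pairwise_compatible ::
    "'a::euclidean_space set \<Rightarrow> ('a \<Rightarrow> real) \<Rightarrow> ('a \<Rightarrow> 'a set) \<Rightarrow> 'a \<Rightarrow> 'a \<Rightarrow> bool" where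
  "pairwise_compatible E f \<Psi> x b \<longleftrightarrow>
     (\<forall>\<epsilon>>0. \<exists>\<delta>>0. \<forall>u\<in>E \<inter> ball x \<delta>. \<forall>v\<in>E \<inter> ball x \<delta>.
        \<exists>c\<in>\<Psi> v. norm (b - c) \<le> \<epsilon> \<and> \<bar>f u - f v - c \<bullet> (u - v)\<bar> \<le> \<epsilon> * dist u v)"

text \<open>\<Psi> is any family containing the gradients of \<Phi>, so that the same lemma serves
  the first refinement, starting from \<open>Gamma1\<close>, and all later ones.\<close>

lemma glaeser_refinement_pairs:
  fixes E :: "(real ^ 'n) set"
  assumes "k \<ge> 2" and x: "x \<in> E"
    and \<Phi>: "\<And>y P. y \<in> E \<Longrightarrow> P \<in> \<Phi> y \<Longrightarrow> \<exists>b\<in>\<Psi> y. P = (\<lambda>z. f y + b \<bullet> (z - y))"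
    and P0: "P0 \<in> glaeser_refinement k E \<Phi> x"
  shows "\<exists>b\<in>\<Psi> x. P0 = (\<lambda>z. f x + b \<bullet> (z - x)) \<and> pairwise_compatible E f \<Psi> x b"
proof -
  define compatible where "compatible = (\<lambda>\<epsilon> (X :: nat \<Rightarrow> real ^ 'n). \<exists>P. P 0 = P0 \<and> (\<forall>j\<le>k. P j \<in> \<Phi> (X j)) \<and>
      (\<forall>i\<le>k. \<forall>j\<le>k. \<bar>P i (X i) - P j (X i)\<bar> \<le> \<epsilon> * dist (X i) (X j) \<and>
         (\<forall>a. \<bar>partial_deriv a (\<lambda>y. P i y - P j y) (X i)\<bar> \<le> \<epsilon>)))"
  have "\<forall>\<epsilon>>0. \<exists>\<delta>>0. \<forall>X. X 0 = x \<and> (\<forall>j\<in>{1..k}. X j \<in> E \<inter> ball x \<delta>) \<longrightarrow> compatible \<epsilon> X"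
    using P0 unfolding glaeser_refinement_def compatible_def mem_Collect_eq power_one_right power_0 mult_1_right
    by (elim conjE all_forward imp_forward ex_forward conj_forward) simp_all
  then have refine: "\<exists>\<delta>>0. \<forall>X. X 0 = x \<and> (\<forall>j\<in>{1..k}. X j \<in> E \<inter> ball x \<delta>) \<longrightarrow> compatible \<epsilon> X"
    if "\<epsilon> > 0" for \<epsilon>
    using that by blast
  obtain \<delta>1 where "\<delta>1 > 0" and \<delta>1: "\<And>X. X 0 = x \<and> (\<forall>j\<in>{1..k}. X j \<in> E \<inter> ball x \<delta>1) \<Longrightarrow> compatible 1 X"
    using refine[OF zero_less_one] by blast
  \<comment> \<open>Index 0 belongs to the membership condition, so placing all points at x shows
    that P0 itself lies in the fibre being refined.\<close>
  have "compatible 1 (\<lambda>_. x)" using x \<open>\<delta>1 > 0\<close> by (intro \<delta>1) simp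
  then have "P0 \<in> \<Phi> x" unfolding compatible_def by blast
  then obtain b where b: "b \<in> \<Psi> x" "P0 = (\<lambda>z. f x + b \<bullet> (z - x))" using \<Phi>[OF x] by blast
  have "\<exists>\<delta>>0. \<forall>u\<in>E \<inter> ball x \<delta>. \<forall>v\<in>E \<inter> ball x \<delta>.
        \<exists>c\<in>\<Psi> v. norm (b - c) \<le> \<epsilon> \<and> \<bar>f u - f v - c \<bullet> (u - v)\<bar> \<le> \<epsilon> * dist u v" if \<epsilon>: "\<epsilon> > 0" for \<epsilon>
  proof -
    \<comment> \<open>The refinement bounds each partial derivative; summing n of them bounds the
      norm of b - c.\<close>
    define \<eta> where "\<eta> = \<epsilon> / real CARD('n)"
    have card: "1 \<le> real CARD('n)" by (simp add: Suc_leI)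
    then have \<eta>: "\<eta> > 0" "\<eta> \<le> \<epsilon>" "real CARD('n) * \<eta> = \<epsilon>"
      using \<epsilon> by (auto simp: \<eta>_def divide_le_eq)
    obtain \<delta> where "\<delta> > 0" and \<delta>: "\<And>X. X 0 = x \<and> (\<forall>j\<in>{1..k}. X j \<in> E \<inter> ball x \<delta>) \<Longrightarrow> compatible \<eta> X"
      using refine[OF \<eta>(1)] by blast
    show ?thesis
    proof (intro exI[of _ \<delta>] conjI \<open>\<delta> > 0\<close> ballI)
      fix u v assume uv: "u \<in> E \<inter> ball x \<delta>" "v \<in> E \<inter> ball x \<delta>"
      \<comment> \<open>Auxiliary points may coincide: all those after the first are placed at
        v.\<close>
      define X where "X = (\<lambda>j::nat. if j = 0 then x else if j = 1 then u else v)"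
      have X: "X 0 = x" "X 1 = u" "X 2 = v" by (auto simp: X_def)
      have "X 0 = x \<and> (\<forall>j\<in>{1..k}. X j \<in> E \<inter> ball x \<delta>)" using uv by (auto simp: X_def)
      from \<delta>[OF this] obtain P where P: "P 0 = P0" "\<And>j. j \<le> k \<Longrightarrow> P j \<in> \<Phi> (X j)"
        "\<And>i j. i \<le> k \<Longrightarrow> j \<le> k \<Longrightarrow> \<bar>P i (X i) - P j (X i)\<bar> \<le> \<eta> * dist (X i) (X j)"
        "\<And>i j a. i \<le> k \<Longrightarrow> j \<le> k \<Longrightarrow> \<bar>partial_deriv a (\<lambda>y. P i y - P j y) (X i)\<bar> \<le> \<eta>"
        unfolding compatible_def by blast
      have k: "0 \<le> k" "1 \<le> k" "2 \<le> k" using \<open>k \<ge> 2\<close> by auto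
      obtain c where c: "c \<in> \<Psi> v" "P 2 = (\<lambda>z. f v + c \<bullet> (z - v))"
        using \<Phi>[OF _ P(2)[OF k(3), unfolded X]] uv by blast
      obtain d where d: "P 1 = (\<lambda>z. f u + d \<bullet> (z - u))"
        using \<Phi>[OF _ P(2)[OF k(2), unfolded X]] uv by blast
      have "((\<lambda>y. P 0 y - P 2 y) has_derivative (\<lambda>h. (b - c) \<bullet> h)) (at x)"
        unfolding P(1) b(2) c(2) by (auto intro!: derivative_eq_intros simp: inner_diff_left)
      from gradient_eq(1)[OF this] have "\<bar>(b - c) $ a\<bar> \<le> \<eta>" for a
        using P(4)[OF k(1) k(3), of a] X by simp
      then have "(\<Sum>a\<in>UNIV. \<bar>(b - c) $ a\<bar>) \<le> real CARD('n) * \<eta>" by (intro sum_bounded_above) auto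
      then have "norm (b - c) \<le> \<epsilon>" using norm_le_l1_cart[of "b - c"] \<eta>(3) by linarith
      moreover have "\<bar>f u - f v - c \<bullet> (u - v)\<bar> \<le> \<eta> * dist u v"
        using P(3)[OF k(2) k(3)] unfolding X c(2) d by (simp add: diff_diff_eq)
      then have "\<bar>f u - f v - c \<bullet> (u - v)\<bar> \<le> \<epsilon> * dist u v"
        using mult_right_mono[OF \<eta>(2), of "dist u v"] by simp
      ultimately show "\<exists>c\<in>\<Psi> v. norm (b - c) \<le> \<epsilon> \<and> \<bar>f u - f v - c \<bullet> (u - v)\<bar> \<le> \<epsilon> * dist u v"
        using c(1) by blast
    qed
  qed
  then have "pairwise_compatible E f \<Psi> x b" by (simp add: pairwise_compatible_def)
  with b show ?thesis by blast
qed

text \<open>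
  Two auxiliary points suffice: the compatibility of the values at \<open>u\<close> and \<open>v\<close>, whose gradients
  are both close to the one at \<open>x\<close>, makes the latter a strict derivative of \<open>f\<close> along \<open>E\<close>.
\<close>

lemma glaeser_iterate_Suc_subset:
  fixes E :: "(real ^ 'n) set"
  assumes "k \<ge> 2" "x \<in> E" "P \<in> glaeser_iterate k E f (Suc l) x"
  shows "\<exists>b \<in> (lsc_part E ^^ l) (strict_gradients E f) x. P = (\<lambda>y. f x + b \<bullet> (y - x))"
  using assms(2,3)
proof (induction l arbitrary: x P)
  case 0
  \<comment> \<open>Before any refinement, the clause on zeros is all that is used of a gradient in
    \<open>Gamma1\<close>.\<close>
  let ?\<Psi> = "\<lambda>y. {b. f y = 0 \<longrightarrow> b = 0}"
  have "\<exists>b\<in>?\<Psi> x. P = (\<lambda>z. f x + b \<bullet> (z - x)) \<and> pairwise_compatible E f ?\<Psi> x b"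
    by (rule glaeser_refinement_pairs[where \<Phi> = "Gamma1 f", OF \<open>k \<ge> 2\<close> \<open>x \<in> E\<close>])
       (use 0 Gamma1_subset in auto)
  then obtain b where b: "f x = 0 \<longrightarrow> b = 0" "P = (\<lambda>z. f x + b \<bullet> (z - x))"
    and pairs: "pairwise_compatible E f ?\<Psi> x b"
    by blast
  have "\<exists>\<delta>>0. \<forall>u\<in>E \<inter> ball x \<delta>. \<forall>v\<in>E \<inter> ball x \<delta>.
        \<bar>f u - f v - b \<bullet> (u - v)\<bar> \<le> \<epsilon> * dist u v" if \<epsilon>: "\<epsilon> > 0" for \<epsilon>
  proof -
    obtain \<delta> where \<delta>: "\<delta> > 0" "\<And>u v. u \<in> E \<inter> ball x \<delta> \<Longrightarrow> v \<in> E \<inter> ball x \<delta> \<Longrightarrow>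
        \<exists>c. norm (b - c) \<le> \<epsilon> / 2 \<and> \<bar>f u - f v - c \<bullet> (u - v)\<bar> \<le> \<epsilon> / 2 * dist u v"
      using pairs half_gt_zero[OF \<epsilon>] unfolding pairwise_compatible_def by meson
    have "\<bar>f u - f v - b \<bullet> (u - v)\<bar> \<le> \<epsilon> * dist u v" if uv: "u \<in> E \<inter> ball x \<delta>" "v \<in> E \<inter> ball x \<delta>" for u v
    proof -
      obtain c where c: "norm (b - c) \<le> \<epsilon> / 2" "\<bar>f u - f v - c \<bullet> (u - v)\<bar> \<le> \<epsilon> / 2 * dist u v"
        using \<delta>(2)[OF uv] by blast
      have "\<bar>(b - c) \<bullet> (u - v)\<bar> \<le> \<epsilon> / 2 * dist u v"
        using Cauchy_Schwarz_ineq2[of "b - c" "u - v"] mult_right_mono[OF c(1), of "dist u v"]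
        by (simp add: dist_norm)
      moreover have "\<epsilon> / 2 * dist u v = \<epsilon> * dist u v / 2" by simp
      ultimately show ?thesis using c(2) unfolding inner_diff_left by linarith
    qed
    with \<delta>(1) show ?thesis by blast
  qed
  with b have "b \<in> strict_gradients E f x" by (simp add: strict_gradients_def)
  with b(2) show ?case by auto
next
  case (Suc l)
  let ?\<Psi> = "(lsc_part E ^^ l) (strict_gradients E f)"
  have "\<exists>b\<in>?\<Psi> x. P = (\<lambda>z. f x + b \<bullet> (z - x)) \<and> pairwise_compatible E f ?\<Psi> x b"
    by (rule glaeser_refinement_pairs[where \<Phi> = "glaeser_iterate k E f (Suc l)", OF \<open>k \<ge> 2\<close> \<open>x \<in> E\<close>])
       (use Suc in auto)
  then obtain b where b: "b \<in> ?\<Psi> x" "P = (\<lambda>z. f x + b \<bullet> (z - x))"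
    and pairs: "pairwise_compatible E f ?\<Psi> x b"
    by blast
  \<comment> \<open>From the second refinement on, only the closeness of the gradient at v to b is
    used.\<close>
  have "b \<in> lsc_part E ?\<Psi> x"
  proof (rule lsc_partI)
    show "b \<in> ?\<Psi> x" by (rule b(1))
    fix \<epsilon> :: real assume \<epsilon>: "\<epsilon> > 0"
    obtain \<delta> where \<delta>: "\<delta> > 0" "\<And>u v. u \<in> E \<inter> ball x \<delta> \<Longrightarrow> v \<in> E \<inter> ball x \<delta> \<Longrightarrow> \<exists>c\<in>?\<Psi> v. norm (b - c) \<le> \<epsilon> / 2"
      using pairs half_gt_zero[OF \<epsilon>] unfolding pairwise_compatible_def by meson
    show "\<exists>\<delta>>0. \<forall>y\<in>E \<inter> ball x \<delta>. \<exists>c\<in>?\<Psi> y. dist b c < \<epsilon>"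
    proof (intro exI[of _ \<delta>] conjI \<delta>(1) ballI)
      fix y assume "y \<in> E \<inter> ball x \<delta>"
      then obtain c where "c \<in> ?\<Psi> y" "norm (b - c) \<le> \<epsilon> / 2" using \<delta>(2) by blast
      then show "\<exists>c\<in>?\<Psi> y. dist b c < \<epsilon>" using \<epsilon> by (intro bexI[of _ c]) (auto simp: dist_norm)
    qed
  qed
  with b(2) show ?case by auto
qed

theorem theorem2p2:
  "\<exists>k0 :: nat. \<forall>k \<ge> k0. \<forall>(E :: (real ^ 'n) set) (f :: real ^ 'n \<Rightarrow> real).
     compact E \<longrightarrow> (\<forall>x\<in>E. 0 \<le> f x) \<longrightarrow>
     (\<forall>x\<in>E. glaeser_iterate k E f (2 * CARD('n) + 3) x \<noteq> {}) \<longrightarrow>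
     (\<exists>F \<in> C1_nonneg. \<forall>x\<in>E. jet1 x F \<in> Gamma1 f x) \<and>
     (\<exists>F \<in> C1_nonneg. \<forall>x\<in>E. F x = f x)"
proof (intro exI[of _ 2] allI impI)
  fix k and E :: "(real ^ 'n) set" and f :: "real ^ 'n \<Rightarrow> real"
  \<comment> \<open>The threshold 2 provides one auxiliary point for u and one for v.\<close>
  assume k: "2 \<le> k" and E: "compact E" and f: "\<forall>x\<in>E. 0 \<le> f x"
    and ne: "\<forall>x\<in>E. glaeser_iterate k E f (2 * CARD('n) + 3) x \<noteq> {}"
  define \<Phi> where "\<Phi> = (\<lambda>l. (lsc_part E ^^ l) (strict_gradients E f))"
  have aff: "affine (\<Phi> l x)" if "x \<in> E" for l x
    unfolding \<Phi>_def using affine_strict_gradients that by (rule affine_lsc_part_funpow)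
  have nonempty: "\<Phi> (2 * CARD('n) + 2) x \<noteq> {}" if x: "x \<in> E" for x
  proof -
    obtain P where "P \<in> glaeser_iterate k E f (Suc (2 * CARD('n) + 2)) x"
      using ne x by (metis add_Suc_right ex_in_conv eval_nat_numeral(3))
    from glaeser_iterate_Suc_subset[OF k x this] show ?thesis by (auto simp: \<Phi>_def)
  qed
  have stable: "\<Phi> (2 * CARD('n) + 2) x = \<Phi> (2 * CARD('n) + 1) x" if x: "x \<in> E" for x
  proof -
    have "\<Phi> (2 * CARD('n) + 2) x \<subseteq> \<Phi> (2 * CARD('n) + 1) x"
      unfolding \<Phi>_def by (rule lsc_part_funpow_antimono) simp
    then have "\<Phi> (2 * CARD('n) + 1) x \<noteq> {}" using nonempty[OF x] by blast
    then have "0 \<le> aff_dim (\<Phi> (2 * CARD('n) + 1) x)"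
      using aff_dim_negative_iff not_le by blast
    \<comment> \<open>Stabilization is applied with k = n: the codimension condition then says that
      the fibre has dimension at least 0, that is, is nonempty.\<close>
    then show ?thesis
      unfolding \<Phi>_def
      by (intro lsc_part_stabilizes x) (auto intro: affine_strict_gradients)
  qed
  have lsc: "lsc_part E (\<Phi> (2 * CARD('n) + 1)) x = \<Phi> (2 * CARD('n) + 1) x" if "x \<in> E" for x
    using stable[OF that] by (simp add: \<Phi>_def)
  have "\<exists>b. continuous_on E b \<and> (\<forall>x\<in>E. b x \<in> \<Phi> (2 * CARD('n) + 1) x)"
  proof (rule lsc_continuous_selection[OF E])
    fix x assume x: "x \<in> E"
    show "\<Phi> (2 * CARD('n) + 1) x \<noteq> {}" using nonempty[OF x] stable[OF x] by simp
    show "convex (\<Phi> (2 * CARD('n) + 1) x)" using aff[OF x] by (rule affine_imp_convex)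
    show "closed (\<Phi> (2 * CARD('n) + 1) x)" using aff[OF x] by (rule affine_closed)
    show "lsc_part E (\<Phi> (2 * CARD('n) + 1)) x = \<Phi> (2 * CARD('n) + 1) x" by (rule lsc[OF x])
  qed
  then obtain b where b: "continuous_on E b" "\<And>x. x \<in> E \<Longrightarrow> b x \<in> \<Phi> (2 * CARD('n) + 1) x" by blast
  have "\<Phi> (2 * CARD('n) + 1) x \<subseteq> strict_gradients E f x" for x
    using lsc_part_funpow_antimono[of 0 "2 * CARD('n) + 1" E "strict_gradients E f" x]
    by (simp add: \<Phi>_def)
  then have "whitney_field E f b"
    using b f by (intro whitney_field_strict_gradients[OF E]) auto
  from nonneg_whitney_extension[OF E this] obtain F g where
    g: "continuous_on UNIV g" "\<And>x. (F has_derivative (\<lambda>h. g x \<bullet> h)) (at x)"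
    and F: "\<And>x. 0 \<le> F x" "bounded (range F)" "bounded (range g)" "\<And>x. x \<in> E \<Longrightarrow> F x = f x"
    by blast
  have pd: "partial_deriv i F = (\<lambda>x. g x $ i)" for i
    using gradient_eq(1)[OF g(2)] by blast
  have "bounded (range (\<lambda>x. g x $ i))" for i
  proof -
    obtain B where "\<And>x. norm (g x) \<le> B" using F(3) by (auto simp: bounded_iff)
    then show ?thesis
      by (intro boundedI[of _ B]) (auto intro: order_trans[OF component_le_norm_cart])
  qed
  then have FC: "F \<in> C1_nonneg"
    using g F by (auto simp: C1_nonneg_def C1_bounded_def pd differentiable_def intro!: continuous_intros)
  \<comment> \<open>F itself witnesses membership, because \<open>Gamma1\<close> fixes the value at
    x and lets the gradient be that of any nonnegative function with this value.\<close>
  have "jet1 x F \<in> Gamma1 f x" if "x \<in> E" for x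
  proof -
    have "jet1 x F \<in> polys1"
      unfolding polys1_def jet1_def
      by (auto intro!: exI[of _ "F x - gradient F x \<bullet> x"] exI[of _ "gradient F x"] simp: inner_diff_right)
    then show ?thesis using FC F(4)[OF that] by (auto simp: Gamma1_def)
  qed
  with FC F(4) show "(\<exists>F \<in> C1_nonneg. \<forall>x\<in>E. jet1 x F \<in> Gamma1 f x) \<and> (\<exists>F \<in> C1_nonneg. \<forall>x\<in>E. F x = f x)"
    by blast
qed

end
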